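(* There is a polynomial-time algorithm that, given a simple graph $G$ of order $n \geq 3$ with $\delta(G) \geq \lfloor n/2 \rfloor$, determines whether $G$ has a Hamiltonian cycle and, if such a cycle exists, outputs a Hamiltonian cycle of $G$.
   Context: $\delta(G)$ denotes the minimum degree of $G$. A Hamiltonian cycle of $G$ is a cycle passing through every vertex of $G$ exactly once. Polynomial time means running time polynomial in $n$. *)

theory Defs
  imports "Graph_Theory.Pair_Digraph" "HOL-Computational_Algebra.Polynomial"
begin

section \<open>Graphs\<close>

text \<open>A finite simple undirected graph is a \<^locale>\<open>pair_graph\<close>: its arc relation is finite,
  irreflexive and symmetric, so every edge is present as two opposite arcs and the degree of a vertex
  is its out-degree.\<close>

definition min_degree :: "'a pair_pre_digraph \<Rightarrow> nat" where
  "min_degree G = Min ((\<lambda>v. out_degree (with_proj G) v) ` pverts G)"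

text \<open>A Hamiltonian cycle is given by the list of its vertices in cyclic order.  The arcs traversed are
  those from each vertex to its cyclic successor.  The length condition excludes the closed walk
  $u, v, u$, which is a cycle of the digraph but not of the undirected graph.\<close>

definition hamiltonian_cycle :: "'a pair_pre_digraph \<Rightarrow> 'a list \<Rightarrow> bool" where
  "hamiltonian_cycle G vs \<longleftrightarrow>
     pre_digraph.cycle (with_proj G) (zip vs (rotate1 vs)) \<and> 3 \<le> length vs \<and> set vs = pverts G"

lemma pawalk_verts_zip: "pawalk_verts u (zip (u # ws) (ws @ [w])) = u # ws @ [w]"
  by (induction ws arbitrary: u) auto

lemma pcas_zip: "pcas a (zip (u # ws) (ws @ [w])) b \<longleftrightarrow> a = u \<and> b = w"
  by (induction ws arbitrary: a u) auto

lemma hamiltonian_cycle_iff: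
  assumes "pair_graph G"
  shows "hamiltonian_cycle G vs \<longleftrightarrow>
    3 \<le> length vs \<and> distinct vs \<and> set vs = pverts G \<and>
    (\<forall>i<length vs. (vs ! i, vs ! (Suc i mod length vs)) \<in> parcs G)"
proof (cases vs)
  case Nil
  then show ?thesis by (simp add: hamiltonian_cycle_def)
next
  case (Cons v ws)
  interpret pair_graph G by fact
  have rot: "rotate1 vs = ws @ [v]" using Cons by simp
  have verts: "pawalk_verts v (zip vs (rotate1 vs)) = v # ws @ [v]"
    using pawalk_verts_zip[of v ws v] Cons rot by simp
  have cas: "pcas u (zip vs (rotate1 vs)) u \<longleftrightarrow> u = v" for u
    using pcas_zip[of u v ws v u] Cons rot by auto
  have arcs: "set (zip vs (rotate1 vs)) \<subseteq> parcs G \<longleftrightarrow>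
      (\<forall>i<length vs. (vs ! i, vs ! (Suc i mod length vs)) \<in> parcs G)"
    by (auto simp: set_zip nth_rotate1)
  have "pre_digraph.cycle (with_proj G) (zip vs (rotate1 vs)) \<longleftrightarrow>
      v \<in> pverts G \<and> set (zip vs (rotate1 vs)) \<subseteq> parcs G \<and> distinct vs"
    unfolding cycle_def awalk_def using verts cas Cons by auto
  then show ?thesis
    unfolding hamiltonian_cycle_def arcs using Cons by auto
qed

section \<open>Random access machine programs\<close>

text \<open>Programs work on finitely many named, unbounded arrays of natural numbers; a scalar variable is
  an array of which only cell 0 is used.  Every operation, including array access by a computed index,
  costs one unit.  Addition and truncated subtraction are the only arithmetic operations, so every unit
  of time increases the maximal bit length of the values and addresses by at most a constant.  Unit
  cost therefore agrees with Turing machine time up to a polynomial, which would fail if there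
  were multiplication.\<close>

type_synonym name = string
type_synonym state = "name \<Rightarrow> nat \<Rightarrow> nat"

datatype aexp = Const nat | Read name aexp | Plus aexp aexp | Minus aexp aexp

datatype bexp = Less aexp aexp | Equal aexp aexp | Not bexp | And bexp bexp

datatype com =
    Skip
  | Write name aexp aexp  \<comment> \<open>array, index, value\<close>
  | Seq com com
  | Cond bexp com com
  | While bexp com

primrec aval :: "aexp \<Rightarrow> state \<Rightarrow> nat" where
  "aval (Const k) s = k"
| "aval (Read x a) s = s x (aval a s)"
| "aval (Plus a b) s = aval a s + aval b s"
| "aval (Minus a b) s = aval a s - aval b s"

primrec acost :: "aexp \<Rightarrow> nat" where
  "acost (Const k) = 1"
| "acost (Read x a) = acost a + 1"
| "acost (Plus a b) = acost a + acost b + 1"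
| "acost (Minus a b) = acost a + acost b + 1"

primrec bval :: "bexp \<Rightarrow> state \<Rightarrow> bool" where
  "bval (Less a b) s \<longleftrightarrow> aval a s < aval b s"
| "bval (Equal a b) s \<longleftrightarrow> aval a s = aval b s"
| "bval (Not b) s \<longleftrightarrow> \<not> bval b s"
| "bval (And b c) s \<longleftrightarrow> bval b s \<and> bval c s"

primrec bcost :: "bexp \<Rightarrow> nat" where
  "bcost (Less a b) = acost a + acost b + 1"
| "bcost (Equal a b) = acost a + acost b + 1"
| "bcost (Not b) = bcost b + 1"
| "bcost (And b c) = bcost b + bcost c + 1"

text \<open>\<^term>\<open>exec c s t s'\<close>: started in \<^term>\<open>s\<close>, program \<^term>\<open>c\<close> terminates after time
  \<^term>\<open>t\<close> in \<^term>\<open>s'\<close>.\<close>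

inductive exec :: "com \<Rightarrow> state \<Rightarrow> nat \<Rightarrow> state \<Rightarrow> bool" where
  Skip: "exec Skip s 1 s"
| Write: "exec (Write x i a) s (acost i + acost a + 1) (s(x := (s x)(aval i s := aval a s)))"
| Seq: "exec c s t s' \<Longrightarrow> exec d s' u s'' \<Longrightarrow> exec (Seq c d) s (t + u) s''"
| CondTrue: "bval b s \<Longrightarrow> exec c s t s' \<Longrightarrow> exec (Cond b c d) s (bcost b + t + 1) s'"
| CondFalse: "\<not> bval b s \<Longrightarrow> exec d s t s' \<Longrightarrow> exec (Cond b c d) s (bcost b + t + 1) s'"
| WhileFalse: "\<not> bval b s \<Longrightarrow> exec (While b c) s (bcost b + 1) s"
| WhileTrue: "bval b s \<Longrightarrow> exec c s t s' \<Longrightarrow> exec (While b c) s' u s'' \<Longrightarrow>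
    exec (While b c) s (bcost b + t + u + 1) s''"

inductive_cases exec_SkipE: "exec Skip s t s'"
inductive_cases exec_WriteE: "exec (Write x i a) s t s'"
inductive_cases exec_SeqE: "exec (Seq c d) s t s'"
inductive_cases exec_CondE: "exec (Cond b c d) s t s'"
inductive_cases exec_WhileE: "exec (While b c) s t s'"

lemma exec_deterministic:
  assumes "exec c s t s'" and "exec c s u s''"
  shows "u = t \<and> s'' = s'"
  using assms
proof (induction arbitrary: u s'' rule: exec.induct)
  case Skip
  then show ?case by (rule exec_SkipE) simp
next
  case Write
  then show ?case by (rule exec_WriteE) simp
next
  case (Seq c s t1 s1 d t2 s2)
  from Seq.prems obtain u1 r u2 where "u = u1 + u2" "exec c s u1 r" "exec d r u2 s''"
    by (rule exec_SeqE)
  with Seq.IH(1)[of u1 r] Seq.IH(2)[of u2 s''] show ?case by simp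
next
  case (CondTrue b s c t s1 d)
  from CondTrue.prems CondTrue.hyps(1) obtain u1 where "u = Suc (bcost b + u1)" "exec c s u1 s''"
    by (auto elim: exec_CondE)
  with CondTrue.IH[of u1 s''] show ?case by simp
next
  case (CondFalse b s d t s1 c)
  from CondFalse.prems CondFalse.hyps(1) obtain u1 where "u = Suc (bcost b + u1)" "exec d s u1 s''"
    by (auto elim: exec_CondE)
  with CondFalse.IH[of u1 s''] show ?case by simp
next
  case (WhileFalse b s c)
  from WhileFalse.prems show ?case
    by (rule exec_WhileE) (simp_all add: WhileFalse.hyps)
next
  case (WhileTrue b s c t1 s1 t2 s2)
  from WhileTrue.prems obtain u1 r u2 where
    "u = Suc (bcost b + u1 + u2)" "exec c s u1 r" "exec (While b c) r u2 s''"
    by (rule exec_WhileE) (simp add: WhileTrue.hyps(1), rule that)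
  with WhileTrue.IH(1)[of u1 r] WhileTrue.IH(2)[of u2 s''] show ?case by simp
qed

text \<open>The input list is placed in array ``in''.  The output list is read off array ``out'', whose
  cell 0 holds the length of that list.\<close>

definition init :: "nat list \<Rightarrow> state" where
  "init xs = (\<lambda>x i. if x = ''in'' \<and> i < length xs then xs ! i else 0)"

definition output_list :: "state \<Rightarrow> nat list" where
  "output_list s = map (\<lambda>i. s ''out'' (Suc i)) [0..<s ''out'' 0]"

definition computes :: "com \<Rightarrow> nat list \<Rightarrow> nat \<Rightarrow> nat list \<Rightarrow> bool" where
  "computes c xs t ys \<longleftrightarrow> (\<exists>s. exec c (init xs) t s \<and> output_list s = ys)"

text \<open>The input for a graph with vertices $0, \ldots, n-1$ is $n$ followed by the rows of the adjacency
  matrix.\<close>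

definition encode_graph :: "nat \<Rightarrow> nat pair_pre_digraph \<Rightarrow> nat list" where
  "encode_graph n G =
     n # concat (map (\<lambda>i. map (\<lambda>j. if (i, j) \<in> parcs G then 1 else 0) [0..<n]) [0..<n])"

end

theory Submission
  imports Defs
begin

text \<open>The algorithm is a local search over the cyclic arrangements of the vertices.  It minimises the
  number of gaps, that is of cyclically consecutive vertices that are not adjacent; a step applies a
  sequence of at most 20 prefix reversals (flips) that lowers this number.

  Suppose that a local minimum has a gap.  Rotate it to a list from $a$ to $b$ with $a$ and $b$ not
  adjacent.  No $v_i$ is adjacent to $b$ while $v_{i+1}$ is adjacent to $a$, as reversing the part
  behind $v_i$ would lower the number of gaps.  Counting degrees, $n = 2k + 1$ and for each $i$ exactly
  one of the two adjacencies holds, so by another reversal there is no second gap.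
  If some $v_i$ is adjacent to $b$ and $v_{i+2}$ to $a$, then there is a cycle $C$ through all vertices
  but $x = v_{i+1}$.  Since $x$ cannot be inserted into $C$, it is adjacent to exactly every other vertex
  of $C$; exchanging it with one of the remaining ones shows that these together with $x$ form an
  independent set of size $k + 1$.  Otherwise $a$ is adjacent to $v_1, \dots, v_k$ only, and the
  same holds for each $v_j$ with $j < k$ after reversing $v_0, \dots, v_j$, so that $v_k$ is a cut vertex.
  In both cases there is no Hamiltonian cycle.\<close>

section \<open>Gaps of cyclic arrangements\<close>

definition gap :: "('a \<Rightarrow> 'a \<Rightarrow> bool) \<Rightarrow> 'a \<Rightarrow> 'a \<Rightarrow> nat" where
  "gap E u v = (if E u v then 0 else 1)"

fun path_gaps :: "('a \<Rightarrow> 'a \<Rightarrow> bool) \<Rightarrow> 'a list \<Rightarrow> nat" where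
  "path_gaps E (x # y # zs) = gap E x y + path_gaps E (y # zs)"
| "path_gaps E _ = 0"

definition gaps :: "('a \<Rightarrow> 'a \<Rightarrow> bool) \<Rightarrow> 'a list \<Rightarrow> nat" where
  "gaps E L = path_gaps E L + gap E (last L) (hd L)"

lemma path_gaps_append:
  "xs \<noteq> [] \<Longrightarrow> ys \<noteq> [] \<Longrightarrow>
   path_gaps E (xs @ ys) = path_gaps E xs + gap E (last xs) (hd ys) + path_gaps E ys"
proof (induction xs)
  case (Cons x xs)
  show ?case
  proof (cases xs)
    case Nil
    then show ?thesis using Cons.prems by (cases ys) auto
  next
    case (Cons y zs)
    then show ?thesis using Cons.IH Cons.prems by simp
  qed
qed simp

lemma path_gaps_rev:
  assumes "\<And>u v. E u v \<Longrightarrow> E v u"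
  shows "path_gaps E (rev xs) = path_gaps E xs"
proof (induction xs)
  case (Cons x xs)
  have g: "gap E u v = gap E v u" for u v
    using assms by (auto simp: gap_def)
  show ?case
    using Cons path_gaps_append[of "rev xs" "[x]" E] g[of x] by (cases xs) auto
qed simp

lemma path_gaps_sum: "path_gaps E (x # xs) = (\<Sum>i<length xs. gap E ((x # xs) ! i) ((x # xs) ! Suc i))"
  by (induction xs arbitrary: x) (simp_all add: sum.lessThan_Suc_shift del: sum.lessThan_Suc)

text \<open>The form with cyclic indices matches both \<open>hamiltonian_cycle_iff\<close> and the
  loop of the program that counts gaps.\<close>

lemma gaps_sum:
  assumes "L \<noteq> []"
  shows "gaps E L = (\<Sum>i<length L. gap E (L ! i) (L ! (Suc i mod length L)))"
proof -
  obtain x xs where L: "L = x # xs" using assms by (cases L) auto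
  have "(\<Sum>i<length xs. gap E (L ! i) (L ! (Suc i mod length L))) =
        (\<Sum>i<length xs. gap E (L ! i) (L ! Suc i))"
    by (rule sum.cong) (auto simp: L)
  then show ?thesis
    by (simp add: gaps_def L path_gaps_sum last_conv_nth)
qed

lemma path_gaps_eq_0_iff: "path_gaps E L = 0 \<longleftrightarrow> successively E L"
  by (induction E L rule: path_gaps.induct) (auto simp: gap_def)

lemma gaps_eq_0_iff: "gaps E L = 0 \<longleftrightarrow> successively E L \<and> E (last L) (hd L)"
  by (auto simp: gaps_def gap_def path_gaps_eq_0_iff)

lemma gaps_eq_0_iff_nth:
  assumes "L \<noteq> []"
  shows "gaps E L = 0 \<longleftrightarrow> (\<forall>i<length L. E (L ! i) (L ! (Suc i mod length L)))"
  by (auto simp: gaps_sum[OF assms] gap_def)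

lemma gaps_le_length: "L \<noteq> [] \<Longrightarrow> gaps E L \<le> length L"
proof -
  assume "L \<noteq> []"
  moreover have "(\<Sum>i<length L. gap E (L ! i) (L ! (Suc i mod length L))) \<le> (\<Sum>i<length L. 1)"
    by (rule sum_mono) (simp add: gap_def)
  ultimately show ?thesis by (simp add: gaps_sum)
qed

lemma gaps_rotate: "gaps E (ys @ xs) = gaps E (xs @ ys)"
  by (cases "xs = []"; cases "ys = []") (simp_all add: gaps_def path_gaps_append)

lemma path_gaps_posE:
  assumes "path_gaps E L \<noteq> 0"
  obtains xs ys where "L = xs @ ys" "xs \<noteq> []" "ys \<noteq> []" "\<not> E (last xs) (hd ys)"
  using assms
proof (induction E L arbitrary: thesis rule: path_gaps.induct)
  case (1 E x y zs)
  show ?case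
  proof (cases "E x y")
    case True
    then have "path_gaps E (y # zs) \<noteq> 0" using 1(3) by (simp add: gap_def)
    then obtain xs ys where "y # zs = xs @ ys" "xs \<noteq> []" "ys \<noteq> []" "\<not> E (last xs) (hd ys)"
      using 1(1) by blast
    then show ?thesis using 1(2)[of "x # xs" ys] by simp
  next
    case False
    then show ?thesis using 1(2)[of "[x]" "y # zs"] by simp
  qed
qed simp_all

section \<open>Flips\<close>

definition flip :: "nat \<Rightarrow> 'a list \<Rightarrow> 'a list" where
  "flip j L = rev (take j L) @ drop j L"

text \<open>Exactly \<open>r\<close> flips are made, but \<open>flip 0\<close> changes nothing, so
  the sets grow with \<open>r\<close>.\<close>

primrec reach :: "nat \<Rightarrow> 'a list \<Rightarrow> 'a list set" where
  "reach 0 L = {L}"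
| "reach (Suc r) L = (\<Union>j\<le>length L. reach r (flip j L))"

lemma length_flip [simp]: "length (flip j L) = length L"
  by (simp add: flip_def)

lemma set_flip [simp]: "set (flip j L) = set L"
  by (metis append_take_drop_id flip_def set_append set_rev)

lemma distinct_flip [simp]: "distinct (flip j L) = distinct L"
  by (metis append_take_drop_id flip_def distinct_append distinct_rev set_rev)

text \<open>Lets the program undo a flip by repeating it, without a saved copy.\<close>

lemma flip_flip: "flip j (flip j L) = L"
  by (cases "j \<le> length L") (simp_all add: flip_def)

lemma nth_flip:
  "i < length L \<Longrightarrow> j \<le> length L \<Longrightarrow> flip j L ! i = (if i < j then L ! (j - Suc i) else L ! i)"
  by (auto simp: flip_def nth_append rev_nth)

lemma set_reach: "M \<in> reach r L \<Longrightarrow> set M = set L"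
  by (induction r arbitrary: L) auto

lemma distinct_reach: "M \<in> reach r L \<Longrightarrow> distinct M = distinct L"
  by (induction r arbitrary: L) (auto, (metis distinct_flip)+)

lemma reach_add: "M \<in> reach r L \<Longrightarrow> K \<in> reach s M \<Longrightarrow> K \<in> reach (r + s) L"
  by (induction r arbitrary: L) auto

lemma self_in_reach: "L \<in> reach r L"
proof (induction r)
  case (Suc r)
  have "flip 0 L = L" by (simp add: flip_def)
  with Suc show ?case by (auto intro!: bexI[of _ 0])
qed simp

lemma reach_mono: "r \<le> s \<Longrightarrow> M \<in> reach r L \<Longrightarrow> M \<in> reach s L"
  using reach_add[OF _ self_in_reach, of M r L "s - r"] by simp

section \<open>Rearrangements within a bounded number of flips\<close>

lemma reach_prefix: "rev xs @ ys \<in> reach 1 (xs @ ys)"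
  by (auto simp: flip_def intro!: bexI[of _ "length xs"])

declare reach.simps [simp del]

text \<open>The segment is carried to the front, reversed there and carried back.\<close>

lemma reach_segment: "xs @ rev ys @ zs \<in> reach 3 (xs @ ys @ zs)"
proof -
  have 1: "rev ys @ rev xs @ zs \<in> reach 1 (xs @ ys @ zs)"
    using reach_prefix[of "xs @ ys" zs] by simp
  have 2: "ys @ rev xs @ zs \<in> reach 1 (rev ys @ rev xs @ zs)"
    using reach_prefix[of "rev ys" "rev xs @ zs"] by simp
  have 3: "xs @ rev ys @ zs \<in> reach 1 (ys @ rev xs @ zs)"
    using reach_prefix[of "ys @ rev xs" zs] by simp
  show ?thesis
    using reach_add[OF reach_add[OF 1 2] 3] by (simp add: numeral_3_eq_3)
qed

lemma reach_rotate: "ys @ xs \<in> reach 3 (xs @ ys)"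
proof -
  have 1: "rev xs @ ys \<in> reach 1 (xs @ ys)"
    by (rule reach_prefix)
  have 2: "rev ys @ xs \<in> reach 1 (rev xs @ ys)"
    using reach_prefix[of "rev xs @ ys" "[]"] by simp
  have 3: "ys @ xs \<in> reach 1 (rev ys @ xs)"
    using reach_prefix[of "rev ys" xs] by simp
  show ?thesis
    using reach_add[OF reach_add[OF 1 2] 3] by (simp add: numeral_3_eq_3)
qed

text \<open>Reversing \<open>ys @ [x]\<close> puts \<open>x\<close> in place but leaves
  \<open>ys\<close> reversed; a second segment reversal repairs that.\<close>

lemma reach_insert_last: "xs @ x # ys \<in> reach 6 (xs @ ys @ [x])"
proof -
  have 1: "xs @ x # rev ys \<in> reach 3 (xs @ ys @ [x])"
    using reach_segment[of xs "ys @ [x]" "[]"] by simp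
  have 2: "xs @ x # ys \<in> reach 3 (xs @ x # rev ys)"
    using reach_segment[of "xs @ [x]" "rev ys" "[]"] by simp
  show ?thesis using reach_add[OF 1 2] by simp
qed

lemma reach_swap_last: "xs @ x # ys @ [y] \<in> reach 6 (xs @ y # ys @ [x])"
proof -
  have 1: "xs @ x # rev ys @ [y] \<in> reach 3 (xs @ y # ys @ [x])"
    using reach_segment[of xs "y # ys @ [x]" "[]"] by simp
  have 2: "xs @ x # ys @ [y] \<in> reach 3 (xs @ x # rev ys @ [y])"
    using reach_segment[of "xs @ [x]" "rev ys" "[y]"] by simp
  show ?thesis using reach_add[OF 1 2] by simp
qed

text \<open>Follows from local minimality of a list with gaps, and is inherited with a smaller
  radius by every list nearby, so that several rearrangements can be chained.\<close>

definition stuck :: "('a \<Rightarrow> 'a \<Rightarrow> bool) \<Rightarrow> nat \<Rightarrow> 'a list \<Rightarrow> bool" where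
  "stuck E r L \<longleftrightarrow> (\<forall>M\<in>reach r L. gaps E M \<noteq> 0)"

lemma stuck_reach: "stuck E r L \<Longrightarrow> M \<in> reach s L \<Longrightarrow> s + t \<le> r \<Longrightarrow> stuck E t M"
  unfolding stuck_def using reach_add reach_mono by blast

text \<open>The cyclic successor is injective on \<open>{..<n}\<close>, so \<open>J\<close> and its
  image are disjoint sets of equal size; in the tight case they partition
  \<open>{..<n}\<close>.\<close>

lemma cyclic_successor_disjoint:
  fixes n :: nat
  assumes "J \<subseteq> {..<n}" and "J \<inter> (\<lambda>i. Suc i mod n) ` J = {}"
  shows "2 * card J \<le> n"
    and "n \<le> 2 * card J \<Longrightarrow> i < n \<Longrightarrow> Suc i mod n \<in> J \<longleftrightarrow> i \<notin> J"
proof -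
  let ?s = "\<lambda>i. Suc i mod n"
  have inj: "inj_on ?s {..<n}"
    by (auto simp: inj_on_def mod_Suc split: if_splits)
  have fin: "finite J" using assms(1) finite_subset by blast
  have "card (?s ` J) = card J"
    using inj assms(1) by (meson card_image inj_on_subset)
  then have c: "card (J \<union> ?s ` J) = 2 * card J"
    using fin assms(2) by (simp add: card_Un_disjoint)
  have sub: "J \<union> ?s ` J \<subseteq> {..<n}" using assms(1) by auto
  show "2 * card J \<le> n"
    using card_mono[OF _ sub] c by simp
  show "?s i \<in> J \<longleftrightarrow> i \<notin> J" if "n \<le> 2 * card J" "i < n"
  proof -
    have "card (J \<union> ?s ` J) = card {..<n}"
      using that(1) c card_mono[OF _ sub] by simp
    then have "J \<union> ?s ` J = {..<n}"
      using sub by (intro card_subset_eq) simp_all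
    then have "?s i \<in> J \<union> ?s ` J" using that(2) by simp
    moreover have "?s i \<in> ?s ` J \<longleftrightarrow> i \<in> J"
      using inj_on_image_mem_iff[OF inj _ assms(1), of i] that(2) by simp
    ultimately show ?thesis using assms(2) by blast
  qed
qed

section \<open>Local minima in graphs of large minimum degree\<close>

locale simple_graph =
  fixes V :: "'a set" and E :: "'a \<Rightarrow> 'a \<Rightarrow> bool"
  assumes finite_V: "finite V"
    and edge_in: "E u v \<Longrightarrow> v \<in> V"
    and edge_sym: "E u v \<Longrightarrow> E v u"
    and edge_irrefl: "\<not> E v v"
begin

definition arrangement :: "'a list \<Rightarrow> bool" where
  "arrangement L \<longleftrightarrow> distinct L \<and> set L = V"

lemma length_arrangement: "arrangement L \<Longrightarrow> length L = card V"
  by (auto simp: arrangement_def distinct_card)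

lemma arrangement_reach: "arrangement L \<Longrightarrow> M \<in> reach r L \<Longrightarrow> arrangement M"
  by (simp add: arrangement_def set_reach distinct_reach)

lemma card_neighbours_nth:
  assumes "arrangement L"
  shows "card {i. i < length L \<and> E v (L ! i)} = card {w. E v w}"
proof (rule bij_betw_same_card[of "nth L"], rule bij_betw_imageI)
  show "inj_on ((!) L) {i. i < length L \<and> E v (L ! i)}"
    using assms by (auto simp: inj_on_def arrangement_def nth_eq_iff_index_eq)
  show "(!) L ` {i. i < length L \<and> E v (L ! i)} = {w. E v w}"
    using assms edge_in by (fastforce simp: arrangement_def in_set_conv_nth)
qed

definition hamiltonian :: bool where
  "hamiltonian \<longleftrightarrow> (\<exists>L. arrangement L \<and> gaps E L = 0)"

section \<open>Obstructions to Hamiltonicity: independent sets and cut vertices\<close>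

text \<open>Along a gapless arrangement the successor of a vertex of \<open>I\<close> lies outside
  \<open>I\<close>, so \<open>cyclic_successor_disjoint\<close> applies to the positions of
  \<open>I\<close>.\<close>

lemma hamiltonian_independent:
  assumes "hamiltonian" and "I \<subseteq> V" and indep: "\<And>u v. u \<in> I \<Longrightarrow> v \<in> I \<Longrightarrow> \<not> E u v"
  shows "2 * card I \<le> card V"
proof (cases "V = {}")
  case True
  with assms(2) show ?thesis by simp
next
  case False
  obtain L where L: "arrangement L" "gaps E L = 0"
    using assms(1) by (auto simp: hamiltonian_def)
  with False have ne: "L \<noteq> []" by (auto simp: arrangement_def)
  let ?n = "length L"
  let ?s = "\<lambda>i. Suc i mod ?n"
  define J where "J = {i. i < ?n \<and> L ! i \<in> I}"
  have "(!) L ` J = I"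
    using L(1) assms(2) by (fastforce simp: J_def arrangement_def in_set_conv_nth)
  moreover have "inj_on ((!) L) J"
    using L(1) by (auto simp: inj_on_def J_def arrangement_def nth_eq_iff_index_eq)
  ultimately have cJ: "card J = card I" by (metis card_image)
  have "J \<inter> ?s ` J = {}"
    using L(2) indep by (auto simp: J_def gaps_eq_0_iff_nth[OF ne])
  then have "2 * card J \<le> ?n"
    by (intro cyclic_successor_disjoint) (auto simp: J_def)
  then show ?thesis using cJ length_arrangement[OF L(1)] by simp
qed

text \<open>Removing \<open>c\<close> from a Hamiltonian cycle leaves a path through all other
  vertices, which can neither enter nor leave \<open>X\<close>.\<close>

lemma hamiltonian_no_cut_vertex:
  assumes "hamiltonian" and "c \<in> V" and "X \<subseteq> V - {c}" and "X \<noteq> {}"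
    and closed: "\<And>u v. u \<in> X \<Longrightarrow> E u v \<Longrightarrow> v \<in> insert c X"
  shows "X = V - {c}"
proof -
  obtain L where L: "arrangement L" "gaps E L = 0"
    using assms(1) by (auto simp: hamiltonian_def)
  obtain ys zs where yz: "L = ys @ c # zs"
    using L(1) assms(2) by (metis arrangement_def split_list)
  define P where "P = zs @ ys"
  have "gaps E (c # P) = 0"
    using gaps_rotate[of E "c # zs" ys] L(2) by (simp add: P_def yz)
  then have succ: "successively E P" by (cases P) (auto simp: gaps_eq_0_iff)
  have P: "set P = V - {c}" "c \<notin> set P"
    using L(1) by (auto simp: P_def yz arrangement_def)
  have "set Q \<subseteq> X \<or> set Q \<inter> X = {}" if "successively E Q" "c \<notin> set Q" for Q
    using that
  proof (induction Q)
    case (Cons x Q)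
    show ?case
    proof (cases Q)
      case (Cons y R)
      then have "E x y" "E y x" "x \<noteq> c" "y \<noteq> c" using Cons.prems edge_sym by auto
      then have "x \<in> X \<longleftrightarrow> y \<in> X" using closed by blast
      then show ?thesis using Cons.IH Cons.prems Cons by auto
    qed auto
  qed simp
  from this[OF succ P(2)] show ?thesis using assms(3,4) P(1) by auto
qed

section \<open>Degree counting at the two ends of an arrangement\<close>

text \<open>Each end has at least \<open>card V div 2\<close> neighbours. Recorded by the positions
  \<open>i\<close> with \<open>M ! Suc i\<close> adjacent to the head, or \<open>M ! i\<close> to
  the last vertex, they form disjoint subsets of \<open>card V - 1\<close> positions; hence the
  order is odd and every estimate is tight.\<close>

lemma degree_sum_ends:
  assumes M: "arrangement M" and ends: "\<not> E (hd M) (last M)" and ne: "M \<noteq> []"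
    and deg: "\<And>v. v \<in> V \<Longrightarrow> card V div 2 \<le> card {w. E v w}"
    and disj: "\<And>i. Suc i < length M \<Longrightarrow> \<not> (E (last M) (M ! i) \<and> E (hd M) (M ! Suc i))"
  shows "card V = Suc (2 * (card V div 2))"
    and "\<And>i. Suc i < length M \<Longrightarrow> E (last M) (M ! i) \<or> E (hd M) (M ! Suc i)"
    and "card {i. Suc i < length M \<and> E (last M) (M ! i)} = card V div 2"
proof -
  define n where "n = length M"
  have n: "n = card V" using length_arrangement[OF M] by (simp add: n_def)
  have n0: "0 < n" using ne by (simp add: n_def)
  have a: "hd M = M ! 0" and b: "last M = M ! (n - 1)"
    using ne by (simp_all add: hd_conv_nth last_conv_nth n_def)
  have V: "hd M \<in> V" "last M \<in> V" using M ne by (auto simp: arrangement_def)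
  define A where "A = {i. Suc i < n \<and> E (hd M) (M ! Suc i)}"
  define B where "B = {i. Suc i < n \<and> E (last M) (M ! i)}"
  have "Suc ` A = {i. i < n \<and> E (hd M) (M ! i)}"
  proof -
    have "\<exists>j. i = Suc j" if "E (hd M) (M ! i)" for i
      using that edge_irrefl a by (cases i) auto
    then show ?thesis by (auto simp: A_def image_iff)
  qed
  moreover have "card (Suc ` A) = card A" by (simp add: card_image)
  ultimately have cA: "card A = card {w. E (hd M) w}"
    using card_neighbours_nth[OF M, of "hd M"] by (simp add: n_def)
  have "B = {i. i < n \<and> E (last M) (M ! i)}"
  proof -
    have "Suc i < n" if "E (last M) (M ! i)" "i < n" for i
      using that edge_irrefl b by (cases "i = n - 1") auto
    then show ?thesis by (auto simp: B_def)
  qed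
  then have cB: "card B = card {w. E (last M) w}"
    using card_neighbours_nth[OF M, of "last M"] by (simp add: n_def)
  have AB: "A \<inter> B = {}" using disj by (auto simp: A_def B_def n_def)
  have sub: "A \<union> B \<subseteq> {..<n - 1}" by (auto simp: A_def B_def)
  then have "finite (A \<union> B)" by (rule finite_subset) simp
  then have fin: "finite A" "finite B" by simp_all
  have "card A + card B = card (A \<union> B)" using AB fin by (simp add: card_Un_disjoint)
  also have "\<dots> \<le> n - 1" using sub by (metis card_lessThan card_mono finite_lessThan)
  finally have le: "card A + card B \<le> n - 1" .
  have ge: "n div 2 \<le> card A" "n div 2 \<le> card B"
    using deg V cA cB n by simp_all
  show odd: "card V = Suc (2 * (card V div 2))"
    using le ge n0 div_mult_mod_eq[of n 2] mod_less_divisor[of 2 n] unfolding n by linarith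
  then have eq: "card A = n div 2" "card B = n div 2" "card A + card B = n - 1"
    using le ge n by linarith+
  then have un: "A \<union> B = {..<n - 1}"
    using sub AB fin by (intro card_subset_eq) (simp_all add: card_Un_disjoint)
  show "E (last M) (M ! i) \<or> E (hd M) (M ! Suc i)" if "Suc i < length M" for i
  proof -
    have "i \<in> A \<union> B" using that by (simp add: un n_def)
    then show ?thesis by (auto simp: A_def B_def)
  qed
  show "card {i. Suc i < length M \<and> E (last M) (M ! i)} = card V div 2"
    using eq(2) n by (simp add: B_def n_def)
qed

lemma successively_rev_edge: "successively E (rev xs) \<longleftrightarrow> successively E xs"
  using path_gaps_rev[of E xs] edge_sym by (simp flip: path_gaps_eq_0_iff)

lemma gap_sym: "gap E u v = gap E v u"
  using edge_sym by (auto simp: gap_def)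

text \<open>Rotation makes a gap the closing pair; reversing a suffix then trades this gap and one
  more pair for two new pairs. Minimality bounds the outcome, and degree counting excludes any
  further gap.\<close>

lemma local_minimum_single_gap:
  assumes L: "arrangement L" and L0: "gaps E L \<noteq> 0"
    and deg: "\<And>v. v \<in> V \<Longrightarrow> card V div 2 \<le> card {w. E v w}"
    and minimal: "\<And>M. M \<in> reach 6 L \<Longrightarrow> gaps E L \<le> gaps E M" and V3: "3 \<le> card V"
  obtains M where "M \<in> reach 3 L" and "successively E M"
proof -
  have ne: "L \<noteq> []" using length_arrangement[OF L] V3 by auto
  obtain M where M: "M \<in> reach 3 L" "gaps E M = gaps E L" "\<not> E (last M) (hd M)"
  proof (cases "E (last L) (hd L)")
    case False
    then show ?thesis using that[of L] self_in_reach by blast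
  next
    case True
    then have "path_gaps E L \<noteq> 0" using L0 by (simp add: gaps_def gap_def)
    then obtain xs ys where "L = xs @ ys" "xs \<noteq> []" "ys \<noteq> []" "\<not> E (last xs) (hd ys)"
      by (rule path_gaps_posE)
    then show ?thesis
      using that[of "ys @ xs"] reach_rotate[of ys xs] gaps_rotate[of E ys xs] by simp
  qed
  have aM: "arrangement M" using arrangement_reach L M(1) by blast
  then have neM: "M \<noteq> []" using length_arrangement[OF aM] V3 by auto
  \<comment> \<open>The \<open>1\<close> on the left is the closing gap of \<open>M\<close>; the
    right side counts the two pairs created by reversing \<open>ys\<close>.\<close>
  have *: "gap E (last xs) (hd ys) + 1 \<le> gap E (last xs) (last M) + gap E (hd M) (hd ys)"
    if "M = xs @ ys" "xs \<noteq> []" "ys \<noteq> []" for xs ys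
  proof -
    have "xs @ rev ys \<in> reach 3 M" using reach_segment[of xs ys "[]"] that by simp
    then have "xs @ rev ys \<in> reach 6 L" using reach_add[OF M(1)] by fastforce
    then have "gaps E M \<le> gaps E (xs @ rev ys)" using minimal M(2) by simp
    moreover have "gaps E M = path_gaps E xs + gap E (last xs) (hd ys) + path_gaps E ys + 1"
      using M(3) that by (simp add: gaps_def path_gaps_append gap_def)
    moreover have "gaps E (xs @ rev ys) =
        path_gaps E xs + gap E (last xs) (last M) + path_gaps E ys + gap E (hd M) (hd ys)"
      using that path_gaps_rev[of E ys] edge_sym
      by (simp add: gaps_def path_gaps_append hd_rev last_rev gap_sym[of "hd ys"])
    ultimately show ?thesis by simp
  qed
  have **: "gap E (M ! i) (M ! Suc i) + 1 \<le> gap E (M ! i) (last M) + gap E (hd M) (M ! Suc i)"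
    if "Suc i < length M" for i
    using *[OF append_take_drop_id[of "Suc i" M, symmetric]] that
    by (simp add: take_Suc_conv_app_nth hd_drop_conv_nth)
  have disj: "\<not> (E (last M) (M ! i) \<and> E (hd M) (M ! Suc i))" if "Suc i < length M" for i
    using **[OF that] gap_sym[of "last M" "M ! i"] by (auto simp: gap_def split: if_splits)
  have ends: "\<not> E (hd M) (last M)" using M(3) edge_sym by blast
  have cover: "E (last M) (M ! i) \<or> E (hd M) (M ! Suc i)" if "Suc i < length M" for i
    using deg disj that by (intro degree_sum_ends(2)[OF aM ends neM]) auto
  \<comment> \<open>At a second gap the left side of \<open>**\<close> is 2, so neither of the new
    pairs is an edge, against \<open>cover\<close>.\<close>
  have "path_gaps E M = 0"
  proof (rule ccontr)
    assume "path_gaps E M \<noteq> 0"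
    then obtain xs ys where xy: "M = xs @ ys" "xs \<noteq> []" "ys \<noteq> []" "\<not> E (last xs) (hd ys)"
      by (rule path_gaps_posE)
    have i: "Suc (length xs - 1) < length M" "M ! (length xs - 1) = last xs"
      "M ! Suc (length xs - 1) = hd ys"
      using xy(2,3) unfolding xy(1) by (auto simp: nth_append last_conv_nth hd_conv_nth)
    show False
      using **[OF i(1)] cover[OF i(1)] xy(4) gap_sym[of "last M" "last xs"] i(2,3)
      by (auto simp: gap_def split: if_splits)
  qed
  with M(1) show ?thesis by (simp add: that path_gaps_eq_0_iff)
qed

section \<open>Cycles that miss a single vertex\<close>

text \<open>Otherwise \<open>x\<close> could be inserted between two consecutive neighbours on the
  cycle, which gives a gapless arrangement within 6 flips.\<close>

lemma stuck_no_consecutive_neighbours: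
  assumes C: "gaps E C = 0" "C \<noteq> []" and stuck: "stuck E 6 (C @ [x])" and i: "i < length C"
  shows "\<not> (E x (C ! i) \<and> E x (C ! (Suc i mod length C)))"
proof
  assume x: "E x (C ! i) \<and> E x (C ! (Suc i mod length C))"
  have succ: "successively E C" "E (last C) (hd C)" using C(1) by (simp_all add: gaps_eq_0_iff)
  show False
  proof (cases "Suc i = length C")
    \<comment> \<open>The pair is the closing one, and the last place is already the right one for
      \<open>x\<close>.\<close>
    case True
    then have "E x (last C)" "E x (hd C)"
      using x C(2) by (simp_all add: last_conv_nth hd_conv_nth flip: True)
    then have "gaps E (C @ [x]) = 0"
      using succ C(2) edge_sym by (simp add: gaps_eq_0_iff successively_append_iff)
    then show False using stuck self_in_reach[of "C @ [x]" 6] by (auto simp: stuck_def)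
  next
    case False
    define xs ys where "xs = take (Suc i) C" and "ys = drop (Suc i) C"
    have xy: "C = xs @ ys" "xs \<noteq> []" "ys \<noteq> []"
      using False i C(2) by (simp_all add: xs_def ys_def)
    have "E x (last xs)" "E x (hd ys)"
      using x False i by (simp_all add: xs_def ys_def take_Suc_conv_app_nth hd_drop_conv_nth)
    then have "gaps E (xs @ x # ys) = 0"
      using succ xy edge_sym by (auto simp: gaps_eq_0_iff successively_append_iff successively_Cons)
    moreover have "xs @ x # ys \<in> reach 6 (C @ [x])"
      using reach_insert_last[of xs x ys] xy(1) by simp
    ultimately show False using stuck by (auto simp: stuck_def)
  qed
qed

text \<open>At least \<open>k\<close> of the \<open>2 * k\<close> positions, no two of them
  cyclically consecutive: the tight case of \<open>cyclic_successor_disjoint\<close>. The value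
  \<open>p\<close> tells whether the even positions are the neighbours.\<close>

lemma stuck_neighbours_alternate:
  assumes "arrangement (C @ [x])" and C: "gaps E C = 0" "length C = 2 * k" "0 < k"
    and stuck: "stuck E 6 (C @ [x])" and deg: "k \<le> card {w. E x w}"
  obtains p where "\<And>i. i < 2 * k \<Longrightarrow> E x (C ! i) \<longleftrightarrow> even i = p"
proof -
  define J where "J = {i. i < 2 * k \<and> E x (C ! i)}"
  have ne: "C \<noteq> []" using C by auto
  have "{i. i < length (C @ [x]) \<and> E x ((C @ [x]) ! i)} = J"
    using edge_irrefl C(2) by (auto simp: J_def nth_append less_Suc_eq)
  then have card: "k \<le> card J"
    using card_neighbours_nth[OF assms(1), of x] deg by simp
  have sub: "J \<subseteq> {..<2 * k}" by (auto simp: J_def)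
  have disj: "J \<inter> (\<lambda>i. Suc i mod (2 * k)) ` J = {}"
    using stuck_no_consecutive_neighbours[OF C(1) ne stuck] C(2) by (auto simp: J_def)
  have step: "Suc i mod (2 * k) \<in> J \<longleftrightarrow> i \<notin> J" if "i < 2 * k" for i
    using cyclic_successor_disjoint(2)[OF sub disj _ that] card by simp
  have parity: "i \<in> J \<longleftrightarrow> even i = (0 \<in> J)" if "i < 2 * k" for i
    using that
  proof (induction i)
    case (Suc i)
    then show ?case using step[of i] by auto
  qed simp
  show ?thesis
  proof (rule that)
    show "E x (C ! i) \<longleftrightarrow> even i = (0 \<in> J)" if "i < 2 * k" for i
      unfolding parity[OF that, symmetric] using that by (simp add: J_def)
  qed
qed

text \<open>The vertices in the class of positions avoided by \<open>x\<close> can be exchanged with \<open>x\<close> one at a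
  time, so each of them avoids the same class; together with \<open>x\<close> they are independent.\<close>

lemma stuck_almost_spanning_cycle:
  assumes a: "arrangement (C @ [x])" and C: "gaps E C = 0" "length C = 2 * k" "0 < k"
    and stuck: "stuck E 12 (C @ [x])" and deg: "\<And>v. v \<in> V \<Longrightarrow> k \<le> card {w. E v w}"
  shows "\<not> hamiltonian"
proof
  assume ham: hamiltonian
  have ne: "C \<noteq> []" using C by auto
  have x: "x \<in> V" "x \<notin> set C" and dC: "distinct C" "set C \<subseteq> V"
    using a by (auto simp: arrangement_def)
  obtain p where p: "E x (C ! i) \<longleftrightarrow> even i = p" if "i < 2 * k" for i
    using stuck_neighbours_alternate[OF a C stuck_reach[OF stuck self_in_reach[of _ 0]] deg[OF x(1)]]
    by auto
  define J where "J = {i. i < 2 * k \<and> even i \<noteq> p}"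
  have swap: "\<not> E (C ! j) (C ! i)" if "i \<in> J" "j \<in> J" for i j
  proof (cases "i = j")
    case False
    have j: "j < length C" "even j \<noteq> p" using that C(2) by (auto simp: J_def)
    \<comment> \<open>\<open>x\<close> takes the place of \<open>C ! j\<close>. This is again a
      cycle, as both cyclic neighbours of position \<open>j\<close> have the parity that
      \<open>x\<close> is adjacent to.\<close>
    define C' where "C' = C[j := x]"
    have "C' @ [C ! j] \<in> reach 6 (C @ [x])"
    proof -
      have "C @ [x] = take j C @ C ! j # drop (Suc j) C @ [x]"
        using id_take_nth_drop[OF j(1)] by simp
      moreover have "C' @ [C ! j] = take j C @ x # drop (Suc j) C @ [C ! j]"
        using j(1) by (simp add: C'_def upd_conv_take_nth_drop)
      ultimately show ?thesis using reach_swap_last by metis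
    qed
    then have R: "stuck E 6 (C' @ [C ! j])" "arrangement (C' @ [C ! j])"
      using stuck_reach[OF stuck] arrangement_reach[OF a] by auto
    have len: "length C' = 2 * k" using C(2) by (simp add: C'_def)
    have nz: "C' \<noteq> []" using len C(3) by auto
    have "E (C' ! i) (C' ! (Suc i mod (2 * k)))" if i: "i < 2 * k" for i
    proof -
      let ?i = "Suc i mod (2 * k)"
      \<comment> \<open>The cycle length is even, so parity also changes at the wrap-around.\<close>
      have par: "even ?i \<longleftrightarrow> odd i" by (simp add: dvd_mod_iff)
      have lt: "?i < 2 * k" using C(3) by simp
      have "E (C ! i) (C ! ?i)" using C(1,2) i gaps_eq_0_iff_nth[OF ne] by auto
      then show ?thesis
        using p[OF i] p[OF lt] par j edge_sym[of x "C ! i"] i lt C(2)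
        by (cases "i = j"; cases "?i = j") (auto simp: C'_def)
    qed
    then have "gaps E C' = 0" using gaps_eq_0_iff_nth[OF nz] len by simp
    moreover have "C ! j \<in> V" using j(1) dC(2) nth_mem by blast
    ultimately obtain q where q: "E (C ! j) (C' ! i) \<longleftrightarrow> even i = q" if "i < 2 * k" for i
      using stuck_neighbours_alternate[OF R(2) _ len C(3) R(1) deg] by blast
    have "\<not> E (C ! j) x" using p[of j] j C(2) edge_sym[of "C ! j" x] by auto
    \<comment> \<open>\<open>x\<close> now sits at position \<open>j\<close>, so
      \<open>C ! j\<close> avoids the parity class of \<open>j\<close>.\<close>
    then have "q \<noteq> even j" using q[of j] j(1) C(2) by (auto simp: C'_def)
    then have "\<not> E (C ! j) (C' ! i)" using q[of i] that j(2) by (auto simp: J_def)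
    then show ?thesis using False by (simp add: C'_def)
  qed (simp add: edge_irrefl)
  define I where "I = insert x ((!) C ` J)"
  have sub: "(!) C ` J \<subseteq> set C" using C(2) by (auto simp: J_def)
  have nx: "\<not> E x (C ! i)" "\<not> E (C ! i) x" if "i \<in> J" for i
    using p that edge_sym[of "C ! i" x] by (auto simp: J_def)
  have "\<not> E u v" if "u \<in> I" "v \<in> I" for u v
    using that swap nx edge_irrefl by (auto simp: I_def)
  moreover have "I \<subseteq> V" using sub dC(2) x(1) by (auto simp: I_def)
  ultimately have "2 * card I \<le> card V"
    using hamiltonian_independent[OF ham] by blast
  moreover have "card V = Suc (2 * k)"
    using length_arrangement[OF a] C(2) by simp
  moreover have "card I = Suc k"
  proof -
    have "inj_on ((!) C) J"
      using dC(1) C(2) by (auto simp: inj_on_def J_def nth_eq_iff_index_eq)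
    then have "card ((!) C ` J) = card J" by (rule card_image)
    moreover have "card J = k"
    proof -
      \<comment> \<open>These are the odd positions if \<open>p\<close> holds, otherwise the even
        ones.\<close>
      have "J = (\<lambda>i. 2 * i + (if p then 1 else 0)) ` {..<k}"
        by (rule set_eqI, cases p; simp add: J_def image_iff Bex_def; presburger)
      then show ?thesis by (simp add: card_image inj_on_def)
    qed
    moreover have "x \<notin> (!) C ` J" using sub x(2) by blast
    moreover have "finite J" by (simp add: J_def)
    ultimately show ?thesis by (simp add: I_def)
  qed
  ultimately show False by simp
qed

section \<open>Gapless paths and cut vertices\<close>

text \<open>With \<open>k = card V div 2\<close>, the positions below \<open>2 * k\<close> adjacent
  to the last vertex are closed upwards: otherwise the head would be adjacent two places beyond one
  of them, which yields a cycle missing a single vertex. There are \<open>k\<close> such positions,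
  so they are the final ones; shifted by one, they are where the head has no neighbours.\<close>

lemma stuck_path_neighbours:
  assumes M: "arrangement M" "successively E M" and stuck: "stuck E 16 M" and ham: hamiltonian
    and deg: "\<And>v. v \<in> V \<Longrightarrow> card V div 2 \<le> card {w. E v w}" and V3: "3 \<le> card V"
  shows "card V = Suc (2 * (card V div 2))"
    and "\<And>i. i < card V \<Longrightarrow> E (hd M) (M ! i) \<longleftrightarrow> 1 \<le> i \<and> i \<le> card V div 2"
proof -
  define k where "k = card V div 2"
  have n: "length M = card V" by (rule length_arrangement[OF M(1)])
  then have ne: "M \<noteq> []" using V3 by auto
  have ends: "\<not> E (hd M) (last M)"
    using stuck self_in_reach[of M 16] M(2) edge_sym by (auto simp: stuck_def gaps_eq_0_iff)
  have disj: "\<not> (E (last M) (M ! i) \<and> E (hd M) (M ! Suc i))" if i: "Suc i < length M" for i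
  proof
    assume e: "E (last M) (M ! i) \<and> E (hd M) (M ! Suc i)"
    define xs ys where "xs = take (Suc i) M" and "ys = drop (Suc i) M"
    have xy: "M = xs @ ys" "xs \<noteq> []" "ys \<noteq> []" using i ne by (simp_all add: xs_def ys_def)
    have "last xs = M ! i" "hd ys = M ! Suc i"
      using i by (simp_all add: xs_def ys_def take_Suc_conv_app_nth hd_drop_conv_nth)
    then have "gaps E (xs @ rev ys) = 0"
      using e M(2) xy edge_sym
      by (simp add: gaps_eq_0_iff successively_append_iff hd_rev last_rev successively_rev_edge
        del: successively_rev)
    moreover have "xs @ rev ys \<in> reach 16 M"
      using reach_segment[of xs ys "[]"] reach_mono[of 3 16] by (simp add: xy(1))
    ultimately show False using stuck by (auto simp: stuck_def)
  qed
  show odd: "card V = Suc (2 * (card V div 2))"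
    using deg disj by (intro degree_sum_ends(1)[OF M(1) ends ne]) auto
  have cover: "E (last M) (M ! i) \<or> E (hd M) (M ! Suc i)" if "Suc i < length M" for i
    using deg disj that by (intro degree_sum_ends(2)[OF M(1) ends ne]) auto
  have k0: "0 < k" using V3 by (simp add: k_def)
  have len: "length M = Suc (2 * k)" using n odd by (simp add: k_def)
  \<comment> \<open>The cycle runs through \<open>xs\<close>, jumps to the last vertex, runs back
    through \<open>ys\<close> and returns to the head. Only \<open>x\<close> is missing, so
    \<open>stuck_almost_spanning_cycle\<close> contradicts Hamiltonicity.\<close>
  have skip: "\<not> E (hd M) (M ! Suc (Suc i))" if i: "Suc (Suc i) < length M" "E (last M) (M ! i)" for i
  proof
    assume e: "E (hd M) (M ! Suc (Suc i))"
    define xs x ys where "xs = take (Suc i) M" and "x = M ! Suc i" and "ys = drop (Suc (Suc i)) M"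
    have xy: "M = xs @ x # ys" "xs \<noteq> []" "ys \<noteq> []"
      using i ne by (simp_all add: xs_def ys_def x_def Cons_nth_drop_Suc)
    have "last xs = M ! i" "hd ys = M ! Suc (Suc i)"
      using i by (simp_all add: xs_def ys_def take_Suc_conv_app_nth hd_drop_conv_nth)
    then have C: "gaps E (xs @ rev ys) = 0"
      using i(2) e M(2) xy edge_sym
      by (auto simp: gaps_eq_0_iff successively_append_iff successively_Cons hd_rev last_rev successively_rev_edge
        simp del: successively_rev)
    have "xs @ rev ys @ [x] \<in> reach 3 M"
      using reach_segment[of xs "x # ys" "[]"] by (simp add: xy(1))
    then have R: "stuck E 12 ((xs @ rev ys) @ [x])" "arrangement ((xs @ rev ys) @ [x])"
      using stuck_reach[OF stuck] arrangement_reach[OF M(1)] by auto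
    have "length (xs @ rev ys) = 2 * k" using len unfolding xy(1) by simp
    then have "\<not> hamiltonian"
      using stuck_almost_spanning_cycle[OF R(2) C _ k0 R(1)] deg by (simp add: k_def)
    with ham show False by simp
  qed
  define B where "B = {i. i < 2 * k \<and> E (last M) (M ! i)}"
  have up: "i + d \<in> B" if "i \<in> B" "i + d < 2 * k" for i d
    using that(2)
  proof (induction d)
    case 0
    then show ?case using that by simp
  next
    case (Suc d)
    then have "i + d \<in> B" by simp
    then show ?case
      using skip[of "i + d"] cover[of "Suc (i + d)"] Suc.prems len by (auto simp: B_def)
  qed
  have cB: "card B = k"
  proof -
    have "card {i. Suc i < length M \<and> E (last M) (M ! i)} = card V div 2"
      using deg disj by (intro degree_sum_ends(3)[OF M(1) ends ne]) auto
    then show ?thesis using len by (simp add: B_def k_def)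
  qed
  \<comment> \<open>An upward closed set of \<open>k\<close> positions below \<open>2 * k\<close>
    cannot start before \<open>k\<close>.\<close>
  have "B \<subseteq> {k..<2 * k}"
  proof
    fix i assume i: "i \<in> B"
    have "{i..<2 * k} \<subseteq> B" using up[OF i] by (auto simp: le_iff_add)
    moreover have "finite B" by (simp add: B_def)
    ultimately have "card {i..<2 * k} \<le> card B" by (rule card_mono[rotated])
    then have "2 * k - i \<le> k" using cB by simp
    then show "i \<in> {k..<2 * k}" using i k0 by (auto simp: B_def)
  qed
  then have B: "B = {k..<2 * k}" using cB by (intro card_subset_eq) simp_all
  show "E (hd M) (M ! i) \<longleftrightarrow> 1 \<le> i \<and> i \<le> card V div 2" if "i < card V" for i
  proof (cases i)
    case 0
    then show ?thesis using edge_irrefl ne by (simp add: hd_conv_nth)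
  next
    case (Suc j)
    then have "j < 2 * k" using that len n by simp
    then have "E (last M) (M ! j) \<longleftrightarrow> k \<le> j" using B by (auto simp: B_def set_eq_iff)
    then show ?thesis
      using cover[of j] disj[of j] Suc that n by (auto simp: k_def)
  qed
qed

text \<open>Suppose that there is a Hamiltonian cycle. For \<open>j < k\<close>, reversing the first
  \<open>j + 1\<close> vertices gives another gapless path, headed by \<open>M ! j\<close>; so the
  first \<open>k\<close> vertices have neighbours only among themselves and \<open>M ! k\<close>,
  which is thus a cut vertex.\<close>

lemma stuck_path_not_hamiltonian:
  assumes M: "arrangement M" "successively E M" and stuck: "stuck E 17 M"
    and deg: "\<And>v. v \<in> V \<Longrightarrow> card V div 2 \<le> card {w. E v w}" and V3: "3 \<le> card V"
  shows "\<not> hamiltonian"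
proof
  assume ham: hamiltonian
  define k where "k = card V div 2"
  have n: "length M = card V" by (rule length_arrangement[OF M(1)])
  then have ne: "M \<noteq> []" using V3 by auto
  have stuck': "stuck E 16 M" using stuck_reach[OF stuck self_in_reach[of _ 0]] by simp
  have odd: "card V = Suc (2 * k)" and nb: "\<And>i. i < card V \<Longrightarrow> E (hd M) (M ! i) \<longleftrightarrow> 1 \<le> i \<and> i \<le> k"
    using stuck_path_neighbours[OF M stuck' ham deg V3] by (simp_all add: k_def)
  have k0: "0 < k" using V3 by (simp add: k_def)
  have initial: "i \<le> k" if j: "j < k" and i: "i < card V" and e: "E (M ! j) (M ! i)" for i j
  proof -
    define K where "K = rev (take (Suc j) M) @ drop (Suc j) M"
    have "K \<in> reach 1 M"
      using reach_prefix[of "take (Suc j) M" "drop (Suc j) M"] by (simp add: K_def)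
    then have K: "stuck E 16 K" "arrangement K"
      using stuck_reach[OF stuck, of K 1 16] arrangement_reach[OF M(1), of K 1] by simp_all
    have jn: "Suc j < length M" using j odd n by simp
    have "successively E (take (Suc j) M)" "successively E (drop (Suc j) M)"
      using M(2) append_take_drop_id[of "Suc j" M] successively_append_iff by metis+
    \<comment> \<open>Position \<open>j + 1\<close> is at most \<open>k\<close>, so the old head is
      adjacent to the first vertex behind the reversed part.\<close>
    moreover have "E (hd M) (hd (drop (Suc j) M))"
      using nb[of "Suc j"] j jn n by (simp add: hd_drop_conv_nth)
    ultimately have sK: "successively E K"
      using ne by (simp add: K_def successively_append_iff last_rev successively_rev_edge
        del: successively_rev)
    have nbK: "E (hd K) (K ! i) \<longleftrightarrow> 1 \<le> i \<and> i \<le> card V div 2"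
      using deg i by (intro stuck_path_neighbours(2)[OF K(2) sK K(1) ham _ V3]) auto
    have hdK: "hd K = M ! j"
      using jn by (simp add: K_def take_Suc_conv_app_nth)
    show ?thesis
    proof (rule ccontr)
      assume "\<not> i \<le> k"
      \<comment> \<open>Positions beyond \<open>k\<close> are not moved by the reversal.\<close>
      then have "K ! i = M ! i" using j i n jn by (simp add: K_def nth_append)
      then show False using nbK hdK e \<open>\<not> i \<le> k\<close> by (simp add: k_def)
    qed
  qed
  define X where "X = (!) M ` {..<k}"
  have V: "V = (!) M ` {..<card V}"
    using M(1) n by (force simp: arrangement_def set_conv_nth)
  have eq: "M ! i = M ! j \<longleftrightarrow> i = j" if "i < card V" "j < card V" for i j
    using M(1) that n by (simp add: arrangement_def nth_eq_iff_index_eq)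
  have "v \<in> insert (M ! k) X" if "u \<in> X" "E u v" for u v
  proof -
    obtain j where j: "j < k" "u = M ! j" using \<open>u \<in> X\<close> by (auto simp: X_def)
    obtain i where i: "i < card V" "v = M ! i"
      using edge_in[OF \<open>E u v\<close>] V by blast
    have "i \<le> k" using initial j i \<open>E u v\<close> by blast
    then show ?thesis using i(2) by (cases "i = k") (auto simp: X_def)
  qed
  moreover have "M ! k \<in> V" using V odd by auto
  moreover have "X \<subseteq> V - {M ! k}"
  proof
    fix v assume "v \<in> X"
    then obtain j where "j < k" "v = M ! j" by (auto simp: X_def)
    then show "v \<in> V - {M ! k}" using V odd eq[of j k] by auto
  qed
  moreover have "X \<noteq> {}" using k0 by (auto simp: X_def)
  ultimately have "X = V - {M ! k}"
    using hamiltonian_no_cut_vertex[OF ham] by blast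
  moreover have "M ! (2 * k) \<in> V - {M ! k}"
  proof -
    have "M ! (2 * k) \<in> V" using V odd by auto
    then show ?thesis using eq[of "2 * k" k] odd k0 by simp
  qed
  moreover have "M ! (2 * k) \<notin> X" 
  proof
    assume "M ! (2 * k) \<in> X"
    then obtain j where "j < k" "M ! (2 * k) = M ! j" by (auto simp: X_def)
    then show False using eq[of "2 * k" j] odd by simp
  qed
  ultimately show False by blast
qed

text \<open>The radius 20 provides 3 flips for the rotation, 1 for the prefix reversal and 16 for
  \<open>stuck_path_neighbours\<close>. The latter uses 3 to reach a cycle missing one vertex and
  then needs 12, namely 6 to exchange the missing vertex and 6 to insert it.\<close>

theorem local_minimum_not_hamiltonian:
  assumes L: "arrangement L" and L0: "gaps E L \<noteq> 0"
    and deg: "\<And>v. v \<in> V \<Longrightarrow> card V div 2 \<le> card {w. E v w}"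
    and minimal: "\<And>M. M \<in> reach 20 L \<Longrightarrow> gaps E L \<le> gaps E M" and V3: "3 \<le> card V"
  shows "\<not> hamiltonian"
proof -
  have "gaps E L \<le> gaps E M" if "M \<in> reach 6 L" for M
    using minimal reach_mono[OF _ that, of 20] by simp
  then obtain M where M: "M \<in> reach 3 L" "successively E M"
    using local_minimum_single_gap[OF L L0 deg _ V3] by blast
  have "stuck E 20 L" using minimal L0 by (fastforce simp: stuck_def)
  then have "stuck E 17 M" using stuck_reach[OF _ M(1)] by simp
  then show ?thesis
    using stuck_path_not_hamiltonian[OF arrangement_reach[OF L M(1)] M(2) _ deg V3] by blast
qed

end

section \<open>Reasoning about running times\<close>

text \<open>Total correctness with \<open>T\<close> as an upper bound only; execution is
  deterministic, so one run speaks for all.\<close>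

definition runs :: "com \<Rightarrow> state \<Rightarrow> nat \<Rightarrow> (state \<Rightarrow> bool) \<Rightarrow> bool" where
  "runs c s T Q \<longleftrightarrow> (\<exists>t s'. exec c s t s' \<and> t \<le> T \<and> Q s')"

lemma runs_conseq:
  "runs c s T Q \<Longrightarrow> T \<le> T' \<Longrightarrow> (\<And>s'. Q s' \<Longrightarrow> Q' s') \<Longrightarrow> runs c s T' Q'"
  unfolding runs_def by (meson le_trans)

lemma runs_Seq:
  assumes "runs c s T P" and "\<And>s'. P s' \<Longrightarrow> runs d s' U Q"
  shows "runs (Seq c d) s (T + U) Q"
  using assms unfolding runs_def by (meson add_mono exec.Seq)

lemma runs_Cond:
  assumes "bval b s \<Longrightarrow> runs c s T Q" and "\<not> bval b s \<Longrightarrow> runs d s T Q"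
  shows "runs (Cond b c d) s (bcost b + T + 1) Q"
proof (cases "bval b s")
  case True
  then obtain t s' where "exec c s t s'" "t \<le> T" "Q s'" using assms(1) by (auto simp: runs_def)
  moreover have "exec (Cond b c d) s (bcost b + t + 1) s'"
    using True calculation(1) by (rule exec.CondTrue)
  ultimately show ?thesis unfolding runs_def by (intro exI[of _ "bcost b + t + 1"] exI[of _ s']) auto
next
  case False
  then obtain t s' where "exec d s t s'" "t \<le> T" "Q s'" using assms(2) by (auto simp: runs_def)
  moreover have "exec (Cond b c d) s (bcost b + t + 1) s'"
    using False calculation(1) by (rule exec.CondFalse)
  ultimately show ?thesis unfolding runs_def by (intro exI[of _ "bcost b + t + 1"] exI[of _ s']) auto
qed

text \<open>The measure starts at most at \<open>K\<close> and drops with each iteration, so there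
  are at most \<open>K\<close> of them, followed by one failing test of the guard.\<close>

lemma runs_While:
  assumes "I s" and "m s \<le> K"
    and "\<And>s. I s \<Longrightarrow> bval b s \<Longrightarrow> runs c s T (\<lambda>s'. I s' \<and> m s' < m s)"
    and "\<And>s. I s \<Longrightarrow> \<not> bval b s \<Longrightarrow> Q s"
  shows "runs (While b c) s (K * (bcost b + T + 1) + bcost b + 1) Q"
  using assms(1,2)
proof (induction K arbitrary: s)
  case 0
  \<comment> \<open>A measure of 0 cannot drop, so the guard is false.\<close>
  have "\<not> bval b s" using assms(3)[OF \<open>I s\<close>] 0 by (auto simp: runs_def)
  then show ?case
    using exec.WhileFalse[of b s c] assms(4) 0 unfolding runs_def by fastforce
next
  case (Suc K)
  show ?case
  proof (cases "bval b s")
    case True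
    obtain t s' where 1: "exec c s t s'" "t \<le> T" "I s'" "m s' < m s"
      using assms(3)[OF Suc.prems(1) True] by (auto simp: runs_def)
    obtain u s'' where 2: "exec (While b c) s' u s''" "u \<le> K * (bcost b + T + 1) + bcost b + 1" "Q s''"
      using Suc.IH[of s'] 1 Suc.prems by (auto simp: runs_def)
    have "exec (While b c) s (bcost b + t + u + 1) s''"
      using True 1(1) 2(1) by (rule exec.WhileTrue)
    moreover have "bcost b + t + u + 1 \<le> Suc K * (bcost b + T + 1) + bcost b + 1"
      using 1(2) 2(2) by simp
    ultimately show ?thesis using 2(3) unfolding runs_def by blast
  next
    case False
    then show ?thesis
      using exec.WhileFalse[of b s c] assms(4) Suc.prems unfolding runs_def
      by (intro exI[of _ "bcost b + 1"] exI[of _ s]) auto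
  qed
qed

section \<open>Loop-free programs and the frame property\<close>

primrec loop_free :: "com \<Rightarrow> bool" where
  "loop_free Skip = True"
| "loop_free (Write x i a) = True"
| "loop_free (Seq c d) = (loop_free c \<and> loop_free d)"
| "loop_free (Cond b c d) = (loop_free c \<and> loop_free d)"
| "loop_free (While b c) = False"

text \<open>Only meaningful for loop-free programs.\<close>

primrec result :: "com \<Rightarrow> state \<Rightarrow> state" where
  "result Skip s = s"
| "result (Write x i a) s = s(x := (s x)(aval i s := aval a s))"
| "result (Seq c d) s = result d (result c s)"
| "result (Cond b c d) s = (if bval b s then result c s else result d s)"
| "result (While b c) s = s"

text \<open>Branches contribute their maximum, so this bounds the time from above; the value for
  loops is a dummy, as in \<open>result\<close>.\<close>

primrec cost :: "com \<Rightarrow> nat" where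
  "cost Skip = 1"
| "cost (Write x i a) = acost i + acost a + 1"
| "cost (Seq c d) = cost c + cost d"
| "cost (Cond b c d) = bcost b + max (cost c) (cost d) + 1"
| "cost (While b c) = 0"

lemma exec_loop_free: "loop_free c \<Longrightarrow> \<exists>t\<le>cost c. exec c s t (result c s)"
proof (induction c arbitrary: s)
  case Skip
  then show ?case using exec.Skip by fastforce
next
  case (Write x i a)
  show ?case
  proof (intro exI conjI)
    show "acost i + acost a + 1 \<le> cost (Write x i a)" by simp
    show "exec (Write x i a) s (acost i + acost a + 1) (result (Write x i a) s)"
      by (simp only: result.simps exec.Write)
  qed
next
  case (Seq c d)
  obtain t where t: "t \<le> cost c" "exec c s t (result c s)" using Seq by auto
  obtain u where u: "u \<le> cost d" "exec d (result c s) u (result d (result c s))" using Seq by auto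
  show ?case
    using exec.Seq[OF t(2) u(2)] t(1) u(1) by (intro exI[of _ "t + u"]) simp
next
  case (Cond b c d)
  show ?case
  proof (cases "bval b s")
    case True
    obtain t where "t \<le> cost c" "exec c s t (result c s)" using Cond by auto
    then show ?thesis
      using exec.CondTrue[OF True] True by (intro exI[of _ "bcost b + t + 1"]) simp
  next
    case False
    obtain t where "t \<le> cost d" "exec d s t (result d s)" using Cond by auto
    then show ?thesis
      using exec.CondFalse[OF False] False by (intro exI[of _ "bcost b + t + 1"]) simp
  qed
qed simp

lemma runs_loop_free: "loop_free c \<Longrightarrow> cost c \<le> T \<Longrightarrow> Q (result c s) \<Longrightarrow> runs c s T Q"
  unfolding runs_def using exec_loop_free le_trans by blast

primrec writes :: "com \<Rightarrow> name set" where
  "writes Skip = {}"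
| "writes (Write x i a) = {x}"
| "writes (Seq c d) = writes c \<union> writes d"
| "writes (Cond b c d) = writes c \<union> writes d"
| "writes (While b c) = writes c"

lemma exec_frame: "exec c s t s' \<Longrightarrow> x \<notin> writes c \<Longrightarrow> s' x = s x"
  by (induction rule: exec.induct) auto

text \<open>Carries unmodified arrays past a subprogram, so that its specification only has to
  mention what it changes.\<close>

lemma runs_frame:
  "runs c s T Q \<Longrightarrow> runs c s T (\<lambda>s'. Q s' \<and> (\<forall>x. x \<notin> writes c \<longrightarrow> s' x = s x))"
  unfolding runs_def using exec_frame by blast

section \<open>The local search program\<close>

abbreviation var :: "name \<Rightarrow> aexp" where
  "var x \<equiv> Read x (Const 0)"

abbreviation assign :: "name \<Rightarrow> aexp \<Rightarrow> com" where
  "assign x a \<equiv> Write x (Const 0) a"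

text \<open>The current arrangement occupies the cells \<open>2, \<dots>, n + 1\<close> of array ``out'', so that a successful
  search only has to write the two leading cells of the output.\<close>

definition tour :: "nat \<Rightarrow> state \<Rightarrow> nat list" where
  "tour n s = map (\<lambda>i. s ''out'' (i + 2)) [0..<n]"

lemma length_tour [simp]: "length (tour n s) = n"
  by (simp add: tour_def)

lemma nth_tour [simp]: "i < n \<Longrightarrow> tour n s ! i = s ''out'' (i + 2)"
  by (simp add: tour_def)

lemma tour_cong: "s ''out'' = s' ''out'' \<Longrightarrow> tour n s = tour n s'"
  by (simp add: tour_def)

abbreviation cell :: "name \<Rightarrow> nat \<Rightarrow> aexp" where
  "cell x d \<equiv> Read ''out'' (Plus (var x) (Const d))"

section \<open>Prefix reversal as a program\<close>

text \<open>\<open>q\<close> is an exclusive upper end, hence the decrement before the swap;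
  \<open>p\<close> advances only after it.\<close>

definition swap_com :: com where
  "swap_com = Seq (assign ''q'' (Minus (var ''q'') (Const 1)))
    (Seq (assign ''t'' (cell ''p'' 2))
    (Seq (Write ''out'' (Plus (var ''p'') (Const 2)) (cell ''q'' 2))
    (Seq (Write ''out'' (Plus (var ''q'') (Const 2)) (var ''t''))
         (assign ''p'' (Plus (var ''p'') (Const 1))))))"

lemma loop_free_swap: "loop_free swap_com" "cost swap_com \<le> 40"
  by (simp_all add: swap_com_def)

definition flip_com :: "name \<Rightarrow> com" where
  "flip_com x = Seq (Seq (assign ''p'' (Const 0)) (assign ''q'' (var x)))
    (While (Less (var ''p'') (var ''q'')) swap_com)"

text \<open>Each pass shrinks the unreversed interval at both ends. The name \<open>x\<close> must
  differ from \<open>p\<close>, which is cleared before \<open>x\<close> is read.\<close>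

lemma runs_flip:
  assumes j: "s x 0 = j" "j \<le> n" and x: "x \<noteq> ''p''"
  shows "runs (flip_com x) s (50 * n + 50) (\<lambda>s'. tour n s' = flip j (tour n s))"
proof -
  define old where "old = (\<lambda>i. s ''out'' (i + 2))"
  \<comment> \<open>Positions below \<open>j\<close> outside the interval from \<open>p\<close> to
    \<open>q\<close> are already mirrored; \<open>p + q = j\<close> makes the two ends mirror
    images.\<close>
  define I where "I = (\<lambda>s'. s' ''p'' 0 + s' ''q'' 0 = j \<and>
    (\<forall>i. s' ''out'' (i + 2) =
      (if i < j \<and> (i < s' ''p'' 0 \<or> s' ''q'' 0 \<le> i) then old (j - Suc i) else old i)))"
  have init: "runs (Seq (assign ''p'' (Const 0)) (assign ''q'' (var x))) s 10
      (\<lambda>s'. I s' \<and> s' ''q'' 0 \<le> n)"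
    by (rule runs_loop_free)
      (use j x in \<open>auto simp: I_def old_def\<close>)
  have step: "runs swap_com s' 40 (\<lambda>s''. I s'' \<and> s'' ''q'' 0 < s' ''q'' 0)"
    if I: "I s'" and pq: "s' ''p'' 0 < s' ''q'' 0" for s'
  proof -
    define p q where "p = s' ''p'' 0" and "q = s' ''q'' 0 - 1"
    have q: "s' ''q'' 0 = Suc q" "p \<le> q" "p + q + 1 = j" using pq I by (auto simp: p_def q_def I_def)
    have cells: "s' ''out'' (i + 2) = (if i < j \<and> (i < p \<or> q < i) then old (j - Suc i) else old i)" for i
      using I q(1) by (auto simp: I_def p_def)
    have out: "result swap_com s' ''out'' = (s' ''out'')(p + 2 := s' ''out'' (q + 2), q + 2 := s' ''out'' (p + 2))"
      by (simp add: swap_com_def p_def q(1))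
    have "result swap_com s' ''out'' (i + 2) =
      (if i < j \<and> (i < p + 1 \<or> q \<le> i) then old (j - Suc i) else old i)" for i
    proof -
      have "j - Suc p = q" "j - Suc q = p" using q by auto
      then show ?thesis unfolding out using q cells[of i] cells[of p] cells[of q] by auto
    qed
    moreover have "result swap_com s' ''p'' 0 = p + 1" "result swap_com s' ''q'' 0 = q"
      by (simp_all add: swap_com_def p_def q(1))
    ultimately have "I (result swap_com s') \<and> result swap_com s' ''q'' 0 < s' ''q'' 0"
      using q by (auto simp: I_def)
    with loop_free_swap show ?thesis by (intro runs_loop_free) simp_all
  qed
  have final: "tour n s' = flip j (tour n s)" if "I s'" "\<not> s' ''p'' 0 < s' ''q'' 0" for s'
  proof (rule nth_equalityI)
    fix i assume "i < length (tour n s')"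
    then have i: "i < n" by simp
    have "s' ''out'' (i + 2) = (if i < j then old (j - Suc i) else old i)"
      using that by (auto simp: I_def)
    then show "tour n s' ! i = flip j (tour n s) ! i"
      using i j by (simp add: nth_flip old_def)
  qed simp
  let ?b = "Less (var ''p'') (var ''q'')"
  have "runs (While ?b swap_com) s' (n * (bcost ?b + 40 + 1) + bcost ?b + 1)
      (\<lambda>s''. tour n s'' = flip j (tour n s))" if "I s' \<and> s' ''q'' 0 \<le> n" for s'
    by (rule runs_While[where I = I and m = "\<lambda>s. s ''q'' 0"]) (use that step final in simp_all)
  from runs_Seq[OF init this] show ?thesis
    unfolding flip_com_def by (rule runs_conseq) simp_all
qed

lemma writes_flip: "writes (flip_com x) = {''p'', ''q'', ''t'', ''out''}"
  by (auto simp: flip_com_def swap_com_def)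

section \<open>Counting gaps as a program\<close>

definition graph_stored :: "nat \<Rightarrow> (nat \<Rightarrow> nat \<Rightarrow> bool) \<Rightarrow> state \<Rightarrow> bool" where
  "graph_stored n E s \<longleftrightarrow> s ''in'' 0 = n \<and>
    (\<forall>u<n. \<forall>v<n. s ''in'' (s ''r'' u + v) = 0 \<longleftrightarrow> \<not> E u v)"

definition count_body :: com where
  "count_body = Seq
    (Cond (Equal (Read ''in'' (Plus (Read ''r'' (cell ''i'' 2)) (cell ''i'' 3))) (Const 0))
      (assign ''c'' (Plus (var ''c'') (Const 1))) Skip)
    (assign ''i'' (Plus (var ''i'') (Const 1)))"

lemma loop_free_count: "loop_free count_body" "cost count_body \<le> 35"
  by (simp_all add: count_body_def)

text \<open>The first vertex is copied behind the last one, so that the closing arc needs no special case.\<close>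

definition count_com :: com where
  "count_com = Seq
    (Seq (Write ''out'' (Plus (var ''in'') (Const 2)) (Read ''out'' (Const 2)))
      (Seq (assign ''i'' (Const 0)) (assign ''c'' (Const 0))))
    (While (Less (var ''i'') (var ''in'')) count_body)"

text \<open>Vertices below \<open>n\<close> keep the lookups inside the stored adjacency
  matrix.\<close>

lemma runs_count:
  assumes G: "graph_stored n E s" and n: "0 < n" and sub: "set (tour n s) \<subseteq> {..<n}"
  shows "runs count_com s (50 * n + 50) (\<lambda>s'. s' ''c'' 0 = gaps E (tour n s) \<and> tour n s' = tour n s)"
proof -
  define L where "L = tour n s"
  define out where "out = (s ''out'')(n + 2 := s ''out'' 2)"
  have L0: "L \<noteq> []" using n by (auto simp: L_def tour_def)
  have out: "out (i + 2) = L ! (i mod n)" if "i \<le> n" for i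
    using that n by (cases "i = n") (auto simp: L_def out_def numeral_2_eq_2)
  have Ln: "L ! i < n" if "i < n" for i
    using sub that nth_mem[of i L] by (auto simp: L_def)
  define I where "I = (\<lambda>s'. s' ''in'' = s ''in'' \<and> s' ''r'' = s ''r'' \<and> s' ''out'' = out \<and>
    s' ''i'' 0 \<le> n \<and> s' ''c'' 0 = (\<Sum>i<s' ''i'' 0. gap E (L ! i) (L ! (Suc i mod n))))"
  have [simp]: "s ''in'' 0 = n" using G by (simp add: graph_stored_def)
  have init: "runs (Seq (Write ''out'' (Plus (var ''in'') (Const 2)) (Read ''out'' (Const 2)))
      (Seq (assign ''i'' (Const 0)) (assign ''c'' (Const 0)))) s 20 (\<lambda>s'. I s' \<and> s' ''i'' 0 = 0)"
    by (rule runs_loop_free)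
      (auto simp: I_def out_def)
  have step: "runs count_body s' 35 (\<lambda>s''. I s'' \<and> n - s'' ''i'' 0 < n - s' ''i'' 0)"
    if I: "I s'" and i: "s' ''i'' 0 < n" for s'
  proof -
    define i where "i = s' ''i'' 0"
    have "s' ''out'' (i + 2) = L ! i" "s' ''out'' (i + 3) = L ! (Suc i mod n)"
      using out[of i] out[of "Suc i"] I i by (auto simp: I_def i_def eval_nat_numeral)
    moreover have "s' ''in'' (s' ''r'' (L ! i) + L ! (Suc i mod n)) = 0 \<longleftrightarrow>
        \<not> E (L ! i) (L ! (Suc i mod n))"
      using G I Ln i n by (simp add: graph_stored_def I_def i_def)
    ultimately have "I (result count_body s')" "result count_body s' ''i'' 0 = Suc i"
      using I i by (auto simp: I_def count_body_def i_def gap_def)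
    then have "I (result count_body s') \<and> n - result count_body s' ''i'' 0 < n - s' ''i'' 0"
      using i by (simp add: i_def)
    with loop_free_count show ?thesis by (intro runs_loop_free) simp_all
  qed
  have final: "s' ''c'' 0 = gaps E L \<and> tour n s' = L" if "I s'" "\<not> s' ''i'' 0 < n" for s'
    using that out gaps_sum[OF L0] by (auto simp: I_def L_def tour_def out_def)
  let ?b = "Less (var ''i'') (var ''in'')"
  have "bval ?b s' \<longleftrightarrow> s' ''i'' 0 < n" if "I s'" for s'
    using that by (simp add: I_def)
  then have "runs (While ?b count_body) s' (n * (bcost ?b + 35 + 1) + bcost ?b + 1)
      (\<lambda>s'. s' ''c'' 0 = gaps E L \<and> tour n s' = L)" if "I s' \<and> s' ''i'' 0 = 0" for s'
    by (intro runs_While[where I = I and m = "\<lambda>s. n - s ''i'' 0"])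
      (use that step final in simp_all)
  from runs_Seq[OF init this] show ?thesis
    unfolding count_com_def L_def by (rule runs_conseq) simp_all
qed

lemma writes_count: "writes count_com = {''out'', ''i'', ''c''}"
  by (auto simp: count_com_def count_body_def)

section \<open>Exhaustive search over flip sequences\<close>

text \<open>Each depth of the nested search needs its own loop variable; the length of the name
  keeps them apart.\<close>

primrec counter :: "nat \<Rightarrow> name" where
  "counter 0 = ''j''"
| "counter (Suc r) = CHR ''j'' # counter r"

lemma counter_Cons: "counter r = CHR ''j'' # tl (counter r)"
  by (cases r) simp_all

lemma length_counter [simp]: "length (counter r) = Suc r"
  by (induction r) simp_all

lemma counter_inject [simp]: "counter r = counter q \<longleftrightarrow> r = q"
proof
  assume "counter r = counter q"
  then have "length (counter r) = length (counter q)" by simp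
  then show "r = q" by simp
qed simp

lemma counter_neq [simp]:
  "counter r \<noteq> ''in''" "counter r \<noteq> ''out''" "counter r \<noteq> ''p''" "counter r \<noteq> ''q''"
  "counter r \<noteq> ''t''" "counter r \<noteq> ''r''" "counter r \<noteq> ''i''" "counter r \<noteq> ''c''"
  "counter r \<noteq> ''f''" "counter r \<noteq> ''g''"
  by (subst counter_Cons; simp)+

lemma neq_counter [simp]:
  "''in'' \<noteq> counter r" "''out'' \<noteq> counter r" "''p'' \<noteq> counter r" "''q'' \<noteq> counter r"
  "''t'' \<noteq> counter r" "''r'' \<noteq> counter r" "''i'' \<noteq> counter r" "''c'' \<noteq> counter r"
  "''f'' \<noteq> counter r" "''g'' \<noteq> counter r"
  by (rule counter_neq[symmetric])+

text \<open>Explores all sequences of \<open>r\<close> flips.  Variable ``g'' holds the best number of gaps so far and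
  ``f'' signals an improvement, upon which the search is left without undoing the flips.\<close>

primrec search :: "nat \<Rightarrow> com" where
  "search 0 = Seq count_com
    (Cond (Less (var ''c'') (var ''g''))
      (Seq (assign ''g'' (var ''c'')) (assign ''f'' (Const 1))) Skip)"
| "search (Suc r) = Seq (assign (counter r) (Const 0))
    (While (And (Equal (var ''f'') (Const 0)) (Not (Less (var ''in'') (var (counter r)))))
      (Seq (flip_com (counter r)) (Seq (search r)
        (Cond (Equal (var ''f'') (Const 0))
          (Seq (flip_com (counter r)) (assign (counter r) (Plus (var (counter r)) (Const 1))))
          Skip))))"

text \<open>An inner search touches only smaller counters, so the loop variable of the surrounding
  level survives it.\<close>

lemma writes_search:
  "writes (search r) \<subseteq> {''out'', ''p'', ''q'', ''t'', ''i'', ''c'', ''f'', ''g''} \<union> counter ` {..<r}"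
  by (induction r) (auto simp: writes_flip writes_count)

primrec search_time :: "nat \<Rightarrow> nat \<Rightarrow> nat" where
  "search_time 0 n = 50 * n + 100"
| "search_time (Suc r) n = (n + 1) * (100 * n + search_time r n + 200) + 50"

text \<open>Success leaves the better arrangement in place; \<open>exhausted\<close>, in contrast,
  also describes the state before a search.\<close>

definition improved :: "nat \<Rightarrow> (nat \<Rightarrow> nat \<Rightarrow> bool) \<Rightarrow> nat \<Rightarrow> state \<Rightarrow> bool" where
  "improved n E b s \<longleftrightarrow> s ''f'' 0 = 1 \<and> s ''g'' 0 < b \<and> s ''g'' 0 = gaps E (tour n s) \<and>
    distinct (tour n s) \<and> set (tour n s) = {..<n}"

definition exhausted :: "nat \<Rightarrow> nat \<Rightarrow> nat list \<Rightarrow> state \<Rightarrow> bool" where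
  "exhausted n b L s \<longleftrightarrow> s ''f'' 0 = 0 \<and> s ''g'' 0 = b \<and> tour n s = L"

lemma graph_stored_cong:
  "s' ''in'' = s ''in'' \<Longrightarrow> s' ''r'' = s ''r'' \<Longrightarrow> graph_stored n E s' = graph_stored n E s"
  by (simp add: graph_stored_def)

text \<open>Stated for an arbitrary bound \<open>b\<close> rather than the gaps of \<open>L\<close>,
  to cover the first round of the main loop, whose \<open>b\<close> exceeds every number of
  gaps.\<close>

lemma runs_search:
  assumes "graph_stored n E s" and "exhausted n b L s" and "0 < n"
    and "distinct L" and "set L = {..<n}"
  shows "runs (search r) s (search_time r n)
    (\<lambda>s'. improved n E b s' \<or> exhausted n b L s' \<and> (\<forall>M\<in>reach r L. b \<le> gaps E M))"
  using assms
proof (induction r arbitrary: s L)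
  case 0
  have L: "tour n s = L" using 0 by (simp add: exhausted_def)
  let ?P = "\<lambda>s'. (s' ''c'' 0 = gaps E (tour n s) \<and> tour n s' = tour n s) \<and>
    (\<forall>x. x \<notin> writes count_com \<longrightarrow> s' x = s x)"
  have 1: "runs count_com s (50 * n + 50) ?P"
    using 0 L by (intro runs_frame runs_count) simp_all
  have 2: "runs (Cond (Less (var ''c'') (var ''g''))
      (Seq (assign ''g'' (var ''c'')) (assign ''f'' (Const 1))) Skip) s' 50
      (\<lambda>s'. improved n E b s' \<or> exhausted n b L s' \<and> (\<forall>M\<in>reach 0 L. b \<le> gaps E M))"
    if P: "?P s'" for s'
  proof -
    have s': "s' ''f'' 0 = 0" "s' ''g'' 0 = b" "s' ''c'' 0 = gaps E L" "tour n s' = L"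
      using P 0 L by (auto simp: writes_count exhausted_def)
    show ?thesis
    proof (rule runs_loop_free)
      let ?s = "s'(''g'' := (s' ''g'')(0 := gaps E L), ''f'' := (s' ''f'')(0 := 1))"
      have "tour n ?s = L" using s' by (simp add: tour_def)
      then show "improved n E b (result (Cond (Less (var ''c'') (var ''g''))
        (Seq (assign ''g'' (var ''c'')) (assign ''f'' (Const 1))) Skip) s') \<or>
        exhausted n b L (result (Cond (Less (var ''c'') (var ''g''))
        (Seq (assign ''g'' (var ''c'')) (assign ''f'' (Const 1))) Skip) s') \<and>
        (\<forall>M\<in>reach 0 L. b \<le> gaps E M)"
        using s' 0 by (auto simp: improved_def exhausted_def reach.simps)
    qed simp_all
  qed
  show ?case
    unfolding search.simps by (rule runs_conseq[OF runs_Seq[OF 1 2]]) simp_all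
next
  case (Suc r)
  let ?J = "counter r"
  define Q where "Q = (\<lambda>s'. improved n E b s' \<or>
    exhausted n b L s' \<and> (\<forall>M\<in>reach (Suc r) L. b \<le> gaps E M))"
  \<comment> \<open>Either a better arrangement has been found, or \<open>L\<close> is restored and
    all first flips below the counter have been explored in vain.\<close>
  define I where "I = (\<lambda>s'. graph_stored n E s' \<and> (improved n E b s' \<or>
    exhausted n b L s' \<and> (\<forall>j<s' ?J 0. \<forall>M\<in>reach r (flip j L). b \<le> gaps E M)))"
  \<comment> \<open>An improvement ends the loop and makes the measure 0; \<open>Suc n\<close>
    appears because the flips of length 0 up to \<open>n\<close> are all tried.\<close>
  define m where "m = (\<lambda>s' :: state. if s' ''f'' 0 = 0 then Suc n - s' ?J 0 else 0)"
  let ?guard = "And (Equal (var ''f'') (Const 0)) (Not (Less (var ''in'') (var ?J)))"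
  let ?next = "Seq (flip_com ?J) (assign ?J (Plus (var ?J) (Const 1)))"
  let ?body = "Seq (flip_com ?J) (Seq (search r) (Cond (Equal (var ''f'') (Const 0)) ?next Skip))"
  have lenL: "length L = n" using Suc.prems(2) by (auto simp: exhausted_def)
  have init: "runs (assign ?J (Const 0)) s 10 (\<lambda>s'. I s' \<and> s' ?J 0 = 0)"
    by (rule runs_loop_free)
      (use Suc.prems in \<open>auto simp: I_def graph_stored_def exhausted_def tour_def\<close>)
  have step: "runs ?body s1 (100 * n + search_time r n + 150) (\<lambda>s'. I s' \<and> m s' < m s1)"
    if I: "I s1" and guard: "bval ?guard s1" for s1
  proof -
    define j where "j = s1 ?J 0"
    have G1: "graph_stored n E s1" using I by (simp add: I_def)
    then have j: "j \<le> n" using guard by (simp add: j_def graph_stored_def not_less)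
    have f0: "s1 ''f'' 0 = 0" using guard by simp
    then have ex: "exhausted n b L s1"
      and before: "\<forall>i<j. \<forall>M\<in>reach r (flip i L). b \<le> gaps E M"
      using I by (auto simp: I_def improved_def j_def)
    have m1: "m s1 = Suc n - j" using f0 by (simp add: m_def j_def)
    let ?P2 = "\<lambda>s2. tour n s2 = flip j L \<and> (\<forall>x. x \<notin> writes (flip_com ?J) \<longrightarrow> s2 x = s1 x)"
    have r1: "runs (flip_com ?J) s1 (50 * n + 50) ?P2"
      using runs_flip[of s1 ?J j n] j ex
      by (intro runs_frame) (simp add: j_def exhausted_def)
    have r2: "runs (Seq (search r) (Cond (Equal (var ''f'') (Const 0)) ?next Skip)) s2
      (search_time r n + (50 * n + 80)) (\<lambda>s'. I s' \<and> m s' < m s1)" if P2: "?P2 s2" for s2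
    proof -
      have fr: "s2 x = s1 x" if "x \<notin> {''p'', ''q'', ''t'', ''out''}" for x
        using P2 that by (simp add: writes_flip)
      have G2: "graph_stored n E s2" using G1 fr by (simp add: graph_stored_cong[of s2 s1])
      have ex2: "exhausted n b (flip j L) s2" using ex P2 fr by (simp add: exhausted_def)
      let ?P3 = "\<lambda>s3. (improved n E b s3 \<or>
        exhausted n b (flip j L) s3 \<and> (\<forall>M\<in>reach r (flip j L). b \<le> gaps E M)) \<and>
        (\<forall>x. x \<notin> writes (search r) \<longrightarrow> s3 x = s2 x)"
      have r3: "runs (search r) s2 (search_time r n) ?P3"
        using Suc.IH[OF G2 ex2] Suc.prems by (intro runs_frame) simp
      have r4: "runs (Cond (Equal (var ''f'') (Const 0)) ?next Skip) s3 (50 * n + 80)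
        (\<lambda>s'. I s' \<and> m s' < m s1)" if P3: "?P3 s3" for s3
      proof -
        have "x \<notin> writes (search r)" if "x \<in> {''in'', ''r'', ?J}" for x
          using writes_search[of r] that by auto
        then have fr3: "s3 ''in'' = s1 ''in''" "s3 ''r'' = s1 ''r''" "s3 ?J = s1 ?J"
          using P3 fr by simp_all
        have G3: "graph_stored n E s3" using G1 fr3 by (simp add: graph_stored_cong[of s3 s1])
        have "runs (Cond (Equal (var ''f'') (Const 0)) ?next Skip) s3
          (bcost (Equal (var ''f'') (Const 0)) + (50 * n + 65) + 1) (\<lambda>s'. I s' \<and> m s' < m s1)"
        proof (rule runs_Cond)
          assume "bval (Equal (var ''f'') (Const 0)) s3"
          then have f3: "s3 ''f'' 0 = 0" by simp
          then have ex3: "exhausted n b (flip j L) s3"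
            and now: "\<forall>M\<in>reach r (flip j L). b \<le> gaps E M"
            using P3 by (auto simp: improved_def)
          let ?P4 = "\<lambda>s4. tour n s4 = L \<and> (\<forall>x. x \<notin> writes (flip_com ?J) \<longrightarrow> s4 x = s3 x)"
          \<comment> \<open>The second flip undoes the first.\<close>
          have r5: "runs (flip_com ?J) s3 (50 * n + 50) ?P4"
            using runs_flip[of s3 ?J j n] j ex3 fr3
            by (intro runs_frame) (simp add: j_def exhausted_def flip_flip)
          have r6: "runs (assign ?J (Plus (var ?J) (Const 1))) s4 15 (\<lambda>s'. I s' \<and> m s' < m s1)"
            if P4: "?P4 s4" for s4
          proof (rule runs_loop_free)
            let ?s = "s4(?J := (s4 ?J)(0 := Suc j))"
            have fr4: "s4 ''in'' = s3 ''in''" "s4 ''r'' = s3 ''r''" "s4 ''f'' = s3 ''f''"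
              "s4 ''g'' = s3 ''g''" "s4 ?J = s3 ?J"
              using P4 by (simp_all add: writes_flip)
            have "graph_stored n E ?s" using G3 fr4 by (simp add: graph_stored_def)
            moreover have "exhausted n b L ?s"
              using ex3 fr4 P4 tour_cong[of ?s s4] by (simp add: exhausted_def)
            moreover have "\<forall>i<Suc j. \<forall>M\<in>reach r (flip i L). b \<le> gaps E M"
              using before now less_Suc_eq by auto
            ultimately have "I ?s" by (simp add: I_def)
            moreover have "m ?s < m s1" using m1 f3 fr4 j by (simp add: m_def)
            moreover have "result (assign ?J (Plus (var ?J) (Const 1))) s4 = ?s"
              using fr4 fr3 by (simp add: j_def)
            ultimately show "I (result (assign ?J (Plus (var ?J) (Const 1))) s4) \<and>
              m (result (assign ?J (Plus (var ?J) (Const 1))) s4) < m s1" by simp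
          qed simp_all
          show "runs ?next s3 (50 * n + 65) (\<lambda>s'. I s' \<and> m s' < m s1)"
            by (rule runs_conseq[OF runs_Seq[OF r5 r6]]) simp_all
        next
          assume "\<not> bval (Equal (var ''f'') (Const 0)) s3"
          then have "s3 ''f'' 0 \<noteq> 0" by simp
          then have "improved n E b s3" "m s3 = 0" using P3 by (auto simp: exhausted_def m_def)
          then have "I s3 \<and> m s3 < m s1" using G3 m1 j by (simp add: I_def)
          then show "runs Skip s3 (50 * n + 65) (\<lambda>s'. I s' \<and> m s' < m s1)"
            by (intro runs_loop_free) simp_all
        qed
        then show ?thesis by (rule runs_conseq) simp_all
      qed
      show ?thesis by (rule runs_Seq[OF r3 r4])
    qed
    show ?thesis by (rule runs_conseq[OF runs_Seq[OF r1 r2]]) simp_all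
  qed
  have final: "Q s'" if I: "I s'" and guard: "\<not> bval ?guard s'" for s'
  proof (cases "s' ''f'' 0 = 0")
    case True
    then have "n < s' ?J 0" using I guard by (simp add: I_def graph_stored_def)
    moreover have "\<forall>j<s' ?J 0. \<forall>M\<in>reach r (flip j L). b \<le> gaps E M" and "exhausted n b L s'"
      using I True by (auto simp: I_def improved_def)
    ultimately have "\<forall>j\<le>n. \<forall>M\<in>reach r (flip j L). b \<le> gaps E M" and "exhausted n b L s'"
      using le_less_trans by blast+
    then show ?thesis by (auto simp: Q_def reach.simps lenL)
  next
    case False
    then show ?thesis using I by (auto simp: I_def Q_def exhausted_def)
  qed
  have loop: "runs (While ?guard ?body) s'
    ((n + 1) * (bcost ?guard + (100 * n + search_time r n + 150) + 1) + bcost ?guard + 1) Q"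
    if "I s' \<and> s' ?J 0 = 0" for s'
    by (rule runs_While[where I = I and m = m]) (use that step final in \<open>auto simp: m_def\<close>)
  show ?case
    unfolding search.simps Q_def[symmetric]
    by (rule runs_conseq[OF runs_Seq[OF init loop]]) (simp_all add: algebra_simps)
qed

text \<open>Each level of nesting raises the degree by one, so the bound is polynomial in
  \<open>n\<close> for each fixed depth \<open>r\<close>.\<close>

lemma search_time_poly: "\<exists>p. \<forall>n. search_time r n = poly p n"
proof (induction r)
  case 0
  show ?case by (rule exI[of _ "[:100, 50:]"]) (simp add: algebra_simps)
next
  case (Suc r)
  then obtain p where "\<forall>n. search_time r n = poly p n" by blast
  then show ?case
    by (intro exI[of _ "[:1, 1:] * ([:200, 100:] + p) + [:50:]"]) (simp add: algebra_simps)
qed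

section \<open>Initialisation and main loop\<close>

definition setup_body :: com where
  "setup_body = Seq (Write ''out'' (Plus (var ''i'') (Const 2)) (var ''i''))
    (Seq (Write ''r'' (Plus (var ''i'') (Const 1)) (Plus (Read ''r'' (var ''i'')) (var ''in'')))
         (assign ''i'' (Plus (var ''i'') (Const 1))))"

text \<open>Array ``r'' holds the offsets of the rows of the adjacency matrix, as there is no
  multiplication to compute them.\<close>

definition setup_com :: com where
  "setup_com = Seq (Seq (assign ''i'' (Const 0)) (Write ''r'' (Const 0) (Const 1)))
    (While (Less (var ''i'') (var ''in'')) setup_body)"

lemma runs_setup:
  assumes "s ''in'' 0 = n"
  shows "runs setup_com s (50 * n + 50)
    (\<lambda>s'. s' ''in'' = s ''in'' \<and> tour n s' = [0..<n] \<and> (\<forall>u<n. s' ''r'' u = 1 + u * n))"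
proof -
  define I where "I = (\<lambda>s' :: state. s' ''in'' = s ''in'' \<and> s' ''i'' 0 \<le> n \<and>
    (\<forall>u<s' ''i'' 0. s' ''out'' (u + 2) = u) \<and> (\<forall>u\<le>s' ''i'' 0. s' ''r'' u = 1 + u * n))"
  let ?b = "Less (var ''i'') (var ''in'')"
  have init: "runs (Seq (assign ''i'' (Const 0)) (Write ''r'' (Const 0) (Const 1))) s 20
      (\<lambda>s'. I s' \<and> s' ''i'' 0 = 0)"
    by (rule runs_loop_free) (auto simp: I_def)
  have step: "runs setup_body s' 35 (\<lambda>s''. I s'' \<and> n - s'' ''i'' 0 < n - s' ''i'' 0)"
    if I: "I s'" and i: "s' ''i'' 0 < n" for s'
  proof (rule runs_loop_free)
    have "I (result setup_body s')" "result setup_body s' ''i'' 0 = Suc (s' ''i'' 0)"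
      using I i assms by (auto simp: I_def setup_body_def less_Suc_eq le_Suc_eq)
    then show "I (result setup_body s') \<and> n - result setup_body s' ''i'' 0 < n - s' ''i'' 0"
      using i by simp
  qed (simp_all add: setup_body_def)
  have final: "s' ''in'' = s ''in'' \<and> tour n s' = [0..<n] \<and> (\<forall>u<n. s' ''r'' u = 1 + u * n)"
    if "I s'" "\<not> s' ''i'' 0 < n" for s'
  proof -
    have "s' ''i'' 0 = n" using that by (simp add: I_def)
    moreover from this have "tour n s' = [0..<n]"
      using that(1) by (intro nth_equalityI) (simp_all add: I_def)
    ultimately show ?thesis using that(1) by (simp add: I_def)
  qed
  have "bval ?b s' \<longleftrightarrow> s' ''i'' 0 < n" if "I s'" for s'
    using that assms by (simp add: I_def)
  then have "runs (While ?b setup_body) s' (n * (bcost ?b + 35 + 1) + bcost ?b + 1)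
      (\<lambda>s'. s' ''in'' = s ''in'' \<and> tour n s' = [0..<n] \<and> (\<forall>u<n. s' ''r'' u = 1 + u * n))"
    if "I s' \<and> s' ''i'' 0 = 0" for s'
    by (intro runs_While[where I = I and m = "\<lambda>s. n - s ''i'' 0"])
      (use that step final in simp_all)
  from runs_Seq[OF init this] show ?thesis
    unfolding setup_com_def by (rule runs_conseq) simp_all
qed

definition output_com :: com where
  "output_com = Cond (Equal (var ''g'') (Const 0))
    (Seq (Write ''out'' (Const 0) (Plus (var ''in'') (Const 1))) (Write ''out'' (Const 1) (Const 1)))
    (Seq (Write ''out'' (Const 0) (Const 1)) (Write ''out'' (Const 1) (Const 0)))"

text \<open>\<open>g\<close> starts above every possible number of gaps, so the first search must
  succeed and replaces \<open>g\<close> by the true count of an arrangement.\<close>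

definition local_search :: "nat \<Rightarrow> com" where
  "local_search r = Seq setup_com
    (Seq (Seq (assign ''g'' (Plus (var ''in'') (Const 1))) (assign ''f'' (Const 1)))
    (Seq (While (Less (Const 0) (var ''f'')) (Seq (assign ''f'' (Const 0)) (search r)))
         output_com))"

lemma output_list_output_com:
  assumes "s ''in'' 0 = n"
  shows "output_list (result output_com s) = (if s ''g'' 0 = 0 then 1 # tour n s else [0])"
proof -
  have "map f [0..<Suc n] = f 0 # map (\<lambda>i. f (Suc i)) [0..<n]" for f :: "nat \<Rightarrow> nat"
    by (simp add: upt_conv_Cons flip: map_Suc_upt del: upt_Suc)
  then show ?thesis
    using assms by (cases "s ''g'' 0 = 0")
      (simp_all add: output_com_def output_list_def tour_def del: upt_Suc, simp)
qed

text \<open>\<open>g + f\<close> starts at \<open>n + 2\<close> and drops in each round: success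
  lowers \<open>g\<close> and ends with \<open>f = 1\<close>, failure keeps \<open>g\<close> and
  ends with \<open>f = 0\<close>. This bounds the number of rounds.\<close>

lemma runs_local_search:
  assumes "s ''in'' 0 = n" and "0 < n"
    and "\<And>u v. u < n \<Longrightarrow> v < n \<Longrightarrow> s ''in'' (1 + u * n + v) = 0 \<longleftrightarrow> \<not> E u v"
  shows "runs (local_search r) s ((n + 2) * (search_time r n + 50) + 50 * n + 200)
    (\<lambda>s'. \<exists>L. distinct L \<and> set L = {..<n} \<and> (\<forall>M\<in>reach r L. gaps E L \<le> gaps E M) \<and>
      output_list s' = (if gaps E L = 0 then 1 # L else [0]))" (is "runs _ _ _ ?Q")
proof -
  define I where "I = (\<lambda>s'. graph_stored n E s' \<and> distinct (tour n s') \<and> set (tour n s') = {..<n} \<and>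
    (s' ''f'' 0 = 1 \<or> s' ''f'' 0 = 0 \<and> (\<forall>M\<in>reach r (tour n s'). s' ''g'' 0 \<le> gaps E M)) \<and>
    (s' ''g'' 0 = n + 1 \<or> s' ''g'' 0 = gaps E (tour n s')))"
  define R where "R = (\<lambda>s'. s' ''in'' 0 = n \<and> s' ''g'' 0 = gaps E (tour n s') \<and>
    distinct (tour n s') \<and> set (tour n s') = {..<n} \<and>
    (\<forall>M\<in>reach r (tour n s'). gaps E (tour n s') \<le> gaps E M))"
  let ?b = "Less (Const 0) (var ''f'')"
  have init: "runs (Seq (assign ''g'' (Plus (var ''in'') (Const 1))) (assign ''f'' (Const 1))) s' 20
      (\<lambda>s'. I s' \<and> s' ''g'' 0 + s' ''f'' 0 = n + 2)"
    if s': "s' ''in'' = s ''in'' \<and> tour n s' = [0..<n] \<and> (\<forall>u<n. s' ''r'' u = 1 + u * n)" for s'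
  proof (rule runs_loop_free)
    let ?s = "s'(''g'' := (s' ''g'')(0 := n + 1), ''f'' := (s' ''f'')(0 := 1))"
    have "tour n ?s = [0..<n]" using s' by (simp add: tour_def)
    moreover have "graph_stored n E ?s" using s' assms by (simp add: graph_stored_def)
    ultimately have "I ?s \<and> ?s ''g'' 0 + ?s ''f'' 0 = n + 2" by (auto simp: I_def)
    moreover have "result (Seq (assign ''g'' (Plus (var ''in'') (Const 1))) (assign ''f'' (Const 1))) s' = ?s"
      using s' assms by simp
    ultimately show "I (result (Seq (assign ''g'' (Plus (var ''in'') (Const 1))) (assign ''f'' (Const 1))) s') \<and>
      result (Seq (assign ''g'' (Plus (var ''in'') (Const 1))) (assign ''f'' (Const 1))) s' ''g'' 0 +
      result (Seq (assign ''g'' (Plus (var ''in'') (Const 1))) (assign ''f'' (Const 1))) s' ''f'' 0 = n + 2"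
      by simp
  qed simp_all
  have step: "runs (Seq (assign ''f'' (Const 0)) (search r)) s1 (5 + search_time r n)
      (\<lambda>s'. I s' \<and> s' ''g'' 0 + s' ''f'' 0 < s1 ''g'' 0 + s1 ''f'' 0)"
    if I: "I s1" and f: "0 < s1 ''f'' 0" for s1
  proof -
    define b where "b = s1 ''g'' 0"
    define L where "L = tour n s1"
    define s2 where "s2 = s1(''f'' := (s1 ''f'')(0 := 0))"
    have L: "distinct L" "set L = {..<n}" using I by (simp_all add: I_def L_def)
    have b: "b = n + 1 \<or> b = gaps E L" using I by (simp add: I_def b_def L_def)
    have f1: "s1 ''f'' 0 = 1" using I f by (auto simp: I_def)
    have 1: "runs (assign ''f'' (Const 0)) s1 5 (\<lambda>s'. s' = s2)"
      by (rule runs_loop_free) (simp_all add: s2_def)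
    have G: "graph_stored n E s2" using I by (simp add: I_def graph_stored_def s2_def)
    have ex: "exhausted n b L s2" by (simp add: exhausted_def b_def L_def s2_def tour_def)
    have 2: "runs (search r) s2 (search_time r n)
      (\<lambda>s'. I s' \<and> s' ''g'' 0 + s' ''f'' 0 < s1 ''g'' 0 + s1 ''f'' 0)"
    proof (rule runs_conseq[OF runs_frame[OF runs_search[OF G ex assms(2) L]] order_refl])
      fix s' assume s': "(improved n E b s' \<or> exhausted n b L s' \<and> (\<forall>M\<in>reach r L. b \<le> gaps E M)) \<and>
        (\<forall>x. x \<notin> writes (search r) \<longrightarrow> s' x = s2 x)"
      have "x \<notin> writes (search r)" if "x \<in> {''in'', ''r''}" for x
        using writes_search[of r] that by auto
      then have G': "graph_stored n E s'" using s' G by (simp add: graph_stored_def)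
      show "I s' \<and> s' ''g'' 0 + s' ''f'' 0 < s1 ''g'' 0 + s1 ''f'' 0"
      proof (cases "improved n E b s'")
        case True
        then show ?thesis using G' f1 by (simp add: I_def improved_def b_def)
      next
        case False
        then have "exhausted n b L s'" "\<forall>M\<in>reach r L. b \<le> gaps E M" using s' by auto
        then show ?thesis using G' f1 L b by (auto simp: I_def exhausted_def b_def)
      qed
    qed
    show ?thesis by (rule runs_Seq[OF 1]) (simp add: 2)
  qed
  \<comment> \<open>The failed search makes \<open>g\<close> a lower bound for all lists in reach,
    among them the arrangement itself, which has at most \<open>n\<close> gaps; so \<open>g\<close>
    is no longer the initial \<open>n + 1\<close>.\<close>
  have final: "R s'" if I: "I s'" and f: "\<not> 0 < s' ''f'' 0" for s'
  proof -
    have "\<forall>M\<in>reach r (tour n s'). s' ''g'' 0 \<le> gaps E M" using I f by (auto simp: I_def)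
    moreover have "tour n s' \<noteq> []" using assms(2) by (auto simp: tour_def)
    then have "gaps E (tour n s') \<le> n" using gaps_le_length[of "tour n s'" E] by simp
    ultimately have "s' ''g'' 0 \<noteq> n + 1" using self_in_reach[of "tour n s'" r] by fastforce
    then have "s' ''g'' 0 = gaps E (tour n s')" using I by (simp add: I_def)
    then show ?thesis
      using I \<open>\<forall>M\<in>reach r (tour n s'). s' ''g'' 0 \<le> gaps E M\<close>
      by (simp add: R_def I_def graph_stored_def)
  qed
  have loop: "runs (While ?b (Seq (assign ''f'' (Const 0)) (search r))) s'
      ((n + 2) * (bcost ?b + (5 + search_time r n) + 1) + bcost ?b + 1) R"
    if "I s' \<and> s' ''g'' 0 + s' ''f'' 0 = n + 2" for s'
    by (rule runs_While[where I = I and m = "\<lambda>s'. s' ''g'' 0 + s' ''f'' 0"])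
      (use that step final in simp_all)
  have out: "runs output_com s' 50 ?Q" if R: "R s'" for s'
  proof (rule runs_loop_free)
    show "?Q (result output_com s')"
      using R output_list_output_com[of s' n]
      by (intro exI[of _ "tour n s'"]) (simp add: R_def)
  qed (simp_all add: output_com_def)
  show ?thesis
    unfolding local_search_def
    by (rule runs_conseq[OF runs_Seq[OF runs_setup[of s n, OF assms(1)]
          runs_Seq[OF init runs_Seq[OF loop out]]]]) (simp_all add: algebra_simps)
qed

section \<open>Correctness of the algorithm\<close>

lemma length_concat_rows: "length (concat (map (\<lambda>i. map (f i) [0..<m]) [0..<k])) = k * m"
  by (induction k) simp_all

lemma nth_concat_rows:
  "u < k \<Longrightarrow> v < m \<Longrightarrow> concat (map (\<lambda>i. map (f i) [0..<m]) [0..<k]) ! (u * m + v) = f u v"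
proof (induction k)
  case (Suc k)
  show ?case
  proof (cases "u < k")
    case True
    have "u * m + v < Suc u * m" using Suc.prems by simp
    also have "\<dots> \<le> k * m" using True by (intro mult_le_mono1) simp
    finally show ?thesis
      using Suc.IH[OF True Suc.prems(2)] by (simp add: nth_append length_concat_rows)
  next
    case False
    then have "u = k" using Suc.prems by simp
    then show ?thesis using Suc.prems by (simp add: nth_append length_concat_rows)
  qed
qed simp

lemma init_encode_graph:
  "init (encode_graph n G) ''in'' 0 = n"
  "u < n \<Longrightarrow> v < n \<Longrightarrow>
    init (encode_graph n G) ''in'' (1 + u * n + v) = (if (u, v) \<in> parcs G then 1 else 0)"
proof -
  show "init (encode_graph n G) ''in'' 0 = n" by (simp add: init_def encode_graph_def)
  assume uv: "u < n" "v < n"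
  have "u * n + v < Suc u * n" using uv by simp
  also have "\<dots> \<le> n * n" using uv by (intro mult_le_mono1) simp
  finally show "init (encode_graph n G) ''in'' (1 + u * n + v) = (if (u, v) \<in> parcs G then 1 else 0)"
    using uv by (simp add: init_def encode_graph_def length_concat_rows nth_concat_rows)
qed

lemma min_degree_le:
  assumes "pair_graph G" and "v \<in> pverts G"
  shows "min_degree G \<le> card {w. (v, w) \<in> parcs G}"
proof -
  interpret pair_graph G by fact
  have "out_arcs (with_proj G) v = Pair v ` {w. (v, w) \<in> parcs G}"
    by (auto simp: out_arcs_def)
  then have "out_degree (with_proj G) v = card {w. (v, w) \<in> parcs G}"
    by (simp add: out_degree_def card_image inj_on_def)
  moreover have "min_degree G \<le> out_degree (with_proj G) v"
    unfolding min_degree_def using assms(2) pair_finite_verts by (intro Min_le) auto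
  ultimately show ?thesis by simp
qed

theorem theorem3:
  shows "\<exists>(alg :: com) (p :: nat poly). \<forall>(n :: nat) (G :: nat pair_pre_digraph).
    pair_graph G \<and> pverts G = {..<n} \<and> n \<ge> 3 \<and> min_degree G \<ge> n div 2 \<longrightarrow>
    (\<exists>t ys. computes alg (encode_graph n G) t ys \<and> t \<le> poly p n \<and>
      (if \<exists>vs. hamiltonian_cycle G vs
       then \<exists>vs. hamiltonian_cycle G vs \<and> ys = 1 # vs
       else ys = [0]))"
proof -
  \<comment> \<open>The depth 20 is the radius in
    \<open>local_minimum_not_hamiltonian\<close>.\<close>
  let ?alg = "local_search 20"
  obtain q where q: "\<And>n. search_time 20 n = poly q n" using search_time_poly by blast
  define p where "p = [:2, 1:] * (q + [:50:]) + [:200, 50:]"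
  have p: "poly p n = (n + 2) * (search_time 20 n + 50) + 50 * n + 200" for n
    by (simp add: p_def q algebra_simps)
  have "\<exists>t ys. computes ?alg (encode_graph n G) t ys \<and> t \<le> poly p n \<and>
      (if \<exists>vs. hamiltonian_cycle G vs
       then \<exists>vs. hamiltonian_cycle G vs \<and> ys = 1 # vs
       else ys = [0])"
    if G: "pair_graph G" and V: "pverts G = {..<n}" and n: "3 \<le> n" and deg: "n div 2 \<le> min_degree G"
    for n and G :: "nat pair_pre_digraph"
  proof -
    let ?E = "\<lambda>u v. (u, v) \<in> parcs G"
    interpret pair_graph G by fact
    have sym: "(v, u) \<in> parcs G" if "(u, v) \<in> parcs G" for u v
      using pair_sym_arcs that by (auto simp: symmetric_def dest: symD)
    have irrefl: "(v, v) \<notin> parcs G" for v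
      using pair_no_loops[of "(v, v)"] by auto
    interpret S: simple_graph "{..<n}" ?E
      by unfold_locales (use sym irrefl in_arcsD2 V in auto)
    \<comment> \<open>An arrangement has length \<open>n\<close>, which is at least 3, so it meets
      the length condition of \<open>hamiltonian_cycle\<close>.\<close>
    have ham: "hamiltonian_cycle G vs \<longleftrightarrow> S.arrangement vs \<and> gaps ?E vs = 0" for vs
    proof -
      have "length vs = n" if "distinct vs" "set vs = {..<n}"
        using that distinct_card by fastforce
      then show ?thesis
        using n gaps_eq_0_iff_nth[of vs ?E]
        unfolding hamiltonian_cycle_iff[OF G] S.arrangement_def V by fastforce
    qed
    obtain t s' where run: "exec ?alg (init (encode_graph n G)) t s'" "t \<le> poly p n"
      and "\<exists>L. distinct L \<and> set L = {..<n} \<and> (\<forall>M\<in>reach 20 L. gaps ?E L \<le> gaps ?E M) \<and>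
        output_list s' = (if gaps ?E L = 0 then 1 # L else [0])"
    proof -
      have "runs ?alg (init (encode_graph n G)) (poly p n)
        (\<lambda>s'. \<exists>L. distinct L \<and> set L = {..<n} \<and> (\<forall>M\<in>reach 20 L. gaps ?E L \<le> gaps ?E M) \<and>
          output_list s' = (if gaps ?E L = 0 then 1 # L else [0]))"
        unfolding p
      proof (rule runs_local_search)
        show "init (encode_graph n G) ''in'' (1 + u * n + v) = 0 \<longleftrightarrow> (u, v) \<notin> parcs G"
          if "u < n" "v < n" for u v
          using init_encode_graph(2)[OF that, of G] by simp
      qed (use n init_encode_graph(1) in simp_all)
      then show ?thesis using that unfolding runs_def by blast
    qed
    then obtain L where L: "S.arrangement L" "\<forall>M\<in>reach 20 L. gaps ?E L \<le> gaps ?E M"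
      and out: "output_list s' = (if gaps ?E L = 0 then 1 # L else [0])"
      unfolding S.arrangement_def by blast
    have "card {..<n} div 2 \<le> card {w. (v, w) \<in> parcs G}" if "v \<in> {..<n}" for v
      using min_degree_le[OF G, of v] deg that V by simp
    \<comment> \<open>The theory of local minima serves the negative answer; a gapless
      \<open>L\<close> is itself a Hamiltonian cycle.\<close>
    then have "\<not> S.hamiltonian" if "gaps ?E L \<noteq> 0"
      using S.local_minimum_not_hamiltonian[OF L(1) that] L(2) n by simp
    then have "if \<exists>vs. hamiltonian_cycle G vs
       then \<exists>vs. hamiltonian_cycle G vs \<and> output_list s' = 1 # vs
       else output_list s' = [0]"
      using out L(1) by (auto simp: ham S.hamiltonian_def)
    then show ?thesis using run unfolding computes_def by blast
  qed
  then show ?thesis by blast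
qed

end
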